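(* Let $k\ge1$, $\beta\in(0,1)$, $0<\varphi_{\text{out}}\le 1/30$, $0<\eta\le1/2$, and $t\ge1$. Let $G=(V_G,E_G)$ be a $(k,\varphi_{\text{out}},\beta)$-unclusterable graph with minimum degree at least $1$ and $\mathrm{vol}(V_G)$ sufficiently large in terms of $k,\beta,\eta$. Let $s=\frac{1600(k+1)^2\ln(12(k+1))\ln(\mathrm{vol}(V_G))}{\beta(1-\eta)}$ and let $S$ be a multiset of $s$ independent samples from a distribution $\mathcal{P}$ on $V_G$ with $|\mathcal{P}(v)-\deg(v)/\mathrm{vol}(V_G)|\le\eta\deg(v)/\mathrm{vol}(V_G)$ for all $v$. Then with probability at least $2/3$, $$\mu_{k+1}\big((D^{-1/2}M^tS)^\top(D^{-1/2}M^tS)\big)\ge\frac{8(k+1)\ln(12(k+1))}{\beta(1-\eta)\,\mathrm{vol}(V_G)}\,(1-30\varphi_{\text{out}})^{2t}.$$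
   Context: $G$ has adjacency matrix $A$ and diagonal degree matrix $D$; $\mathrm{vol}(S)=\sum_{v\in S}\deg(v)$; $\phi^G_{V_G}(C)=|E(C,V_G\setminus C)|/\mathrm{vol}(C)$. $G$ is $(k,\varphi,\beta)$-unclusterable if $V_G$ contains $k+1$ pairwise disjoint subsets $C_1,\dots,C_{k+1}$ with $\mathrm{vol}(C_i)\ge\beta\,\mathrm{vol}(V_G)/(k+1)$ and $\phi^G_{V_G}(C_i)\le\varphi$. $M=(I+AD^{-1})/2$ is the lazy random walk matrix. A multiset $S=\{a_1,\dots,a_s\}$ is identified with the $V_G\times s$ matrix with columns $\mathbb{1}_{a_i}$; $\mu_h(B)$ is the $h$-th largest eigenvalue of symmetric $B$. *)

theory Defs
  imports "Jordan_Normal_Form.Char_Poly" "HOL-Probability.Product_PMF"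
begin

definition simple_graph :: "nat \<Rightarrow> (nat \<Rightarrow> nat \<Rightarrow> bool) \<Rightarrow> bool" where
  "simple_graph n E \<longleftrightarrow> (\<forall>u v. E u v \<longrightarrow> u < n \<and> v < n) \<and>
     (\<forall>u v. E u v \<longrightarrow> E v u) \<and> (\<forall>u. \<not> E u u)"

definition deg :: "nat \<Rightarrow> (nat \<Rightarrow> nat \<Rightarrow> bool) \<Rightarrow> nat \<Rightarrow> nat" where
  "deg n E v = card {u. u < n \<and> E v u}"

definition vol :: "nat \<Rightarrow> (nat \<Rightarrow> nat \<Rightarrow> bool) \<Rightarrow> nat set \<Rightarrow> nat" where
  "vol n E S = (\<Sum>v\<in>S. deg n E v)"

definition cut_edges :: "nat \<Rightarrow> (nat \<Rightarrow> nat \<Rightarrow> bool) \<Rightarrow> nat set \<Rightarrow> nat" where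
  "cut_edges n E C = card {(u, v). u \<in> C \<and> v < n \<and> v \<notin> C \<and> E u v}"

definition conductance :: "nat \<Rightarrow> (nat \<Rightarrow> nat \<Rightarrow> bool) \<Rightarrow> nat set \<Rightarrow> real" where
  "conductance n E C = real (cut_edges n E C) / real (vol n E C)"

definition unclusterable :: "nat \<Rightarrow> (nat \<Rightarrow> nat \<Rightarrow> bool) \<Rightarrow> nat \<Rightarrow> real \<Rightarrow> real \<Rightarrow> bool" where
  "unclusterable n E k \<phi> \<beta> \<longleftrightarrow>
     (\<exists>C :: nat \<Rightarrow> nat set.
        (\<forall>i < k + 1. C i \<subseteq> {..<n}) \<and>
        (\<forall>i < k + 1. \<forall>j < k + 1. i \<noteq> j \<longrightarrow> C i \<inter> C j = {}) \<and>
        (\<forall>i < k + 1. real (vol n E (C i)) \<ge> \<beta> * real (vol n E {..<n}) / real (k + 1)) \<and>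
        (\<forall>i < k + 1. conductance n E (C i) \<le> \<phi>))"

definition adj_mat :: "nat \<Rightarrow> (nat \<Rightarrow> nat \<Rightarrow> bool) \<Rightarrow> real mat" where
  "adj_mat n E = Matrix.mat n n (\<lambda>(i, j). if E i j then 1 else 0)"

definition deg_inv_mat :: "nat \<Rightarrow> (nat \<Rightarrow> nat \<Rightarrow> bool) \<Rightarrow> real mat" where
  "deg_inv_mat n E = Matrix.mat n n (\<lambda>(i, j). if i = j then 1 / real (deg n E i) else 0)"

definition deg_inv_sqrt_mat :: "nat \<Rightarrow> (nat \<Rightarrow> nat \<Rightarrow> bool) \<Rightarrow> real mat" where
  "deg_inv_sqrt_mat n E = Matrix.mat n n (\<lambda>(i, j). if i = j then 1 / sqrt (real (deg n E i)) else 0)"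

definition lazy_walk :: "nat \<Rightarrow> (nat \<Rightarrow> nat \<Rightarrow> bool) \<Rightarrow> real mat" where
  "lazy_walk n E = (1 / 2 :: real) \<cdot>\<^sub>m (1\<^sub>m n + adj_mat n E * deg_inv_mat n E)"

text \<open>The multiset of samples a_0,...,a_{s-1} as the n x s matrix with columns indicator vectors.\<close>
definition sample_mat :: "nat \<Rightarrow> nat \<Rightarrow> (nat \<Rightarrow> nat) \<Rightarrow> real mat" where
  "sample_mat n s a = Matrix.mat n s (\<lambda>(i, j). if a j = i then 1 else 0)"

definition eigenvalues_mset :: "real mat \<Rightarrow> real multiset" where
  "eigenvalues_mset B = proots (char_poly B)"

definition mu :: "nat \<Rightarrow> real mat \<Rightarrow> real" where
  "mu h B = rev (sorted_list_of_multiset (eigenvalues_mset B)) ! (h - 1)"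

end

(* Let N = (1 + D^(-1/2) A D^(-1/2)) / 2, so that D^(-1/2) M^t = N^t D^(-1/2), and let Q be the
   projection onto the eigenvectors of N with eigenvalue at least 1 - 30 phi.  On the image of Q the
   power N^(2t) is at least (1 - 30 phi)^(2t), which removes t from the problem.  A step function
   z = sum_i alpha_i 1_{C_i} sqrt(deg) has Dirichlet energy at most phi |z|^2, so |z - Qz|^2 is at
   most |z|^2 / 30.  Take as test space for the Gram matrix the coefficients x_j = alpha_i for
   a_j in C_i, and put tau = D^(-1/2) S x.  By Cauchy-Schwarz |Q tau| |z| >= <tau, Qz>, and the right
   side is a quadratic form in alpha, a sum of s independent terms.  Its mean is at least
   0.3 s |z|^2 / vol, and since only (k+1)^2 coefficients fluctuate, Chebyshev's inequality
   controls the deviation once s is large compared with (k+1)^2 / beta^2.  The factor ln vol in s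
   provides exactly this when vol >= exp(1/beta); no matrix concentration is needed. *)

theory Submission
  imports Defs "Jordan_Normal_Form.Schur_Decomposition"
begin

text \<open>A direct bound on |Q tau|^2 would involve pairs of samples. For fixed alpha the pairing
  <tau, Qz> is linear in the samples, because Qz is determined before sampling; this reduces the
  probability to a variance computation. The eigenvalue bound needs every alpha at once, and a
  single event delivers that: the (k+1) x (k+1) matrix of coefficient deviations is small in
  Frobenius norm. The expected square of that norm is at most 3s/2, without a factor depending on k,
  since the clusters are disjoint. The mean scales with |z|^2 but the deviation with |alpha|^2. The
  inequality |z|^2 >= (beta vol / (k+1)) |alpha|^2, which expresses that all clusters are large,
  links the two. Constants, in units of s |z|^2 / vol: the sampling weights lie within factors 1/2
  and 3/2 of stationarity, so the mean is at least 3/8 - (3/2)/30 > 3/10. The deviation may take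
  1/5, and 1/10 survives; its square is the 1/100 of the Gram bound.\<close>

unbundle no vec_syntax
unbundle no inner_syntax
hide_type (open) Finite_Cartesian_Product.vec
hide_const (open) Finite_Cartesian_Product.mat Finite_Cartesian_Product.vec
  Finite_Cartesian_Product.row Finite_Cartesian_Product.column Determinants.det

section \<open>Real symmetric matrices\<close>

lemma orthonormal_parseval:
  fixes u :: "nat \<Rightarrow> real vec"
  assumes u: "\<And>i. i < n \<Longrightarrow> u i \<in> carrier_vec n"
    and orth: "\<And>i j. i < n \<Longrightarrow> j < n \<Longrightarrow> u i \<bullet> u j = (if i = j then 1 else 0)"
    and x: "x \<in> carrier_vec n" and y: "y \<in> carrier_vec n"
  shows "x \<bullet> y = (\<Sum>i<n. (u i \<bullet> x) * (u i \<bullet> y))"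
proof -
  define P where "P = mat n n (\<lambda>(i, j). u i $ j)"
  have P: "P \<in> carrier_mat n n" by (simp add: P_def)
  have row: "row P i = u i" if "i < n" for i
    using u[OF that] that by (auto simp: P_def)
  have "P * transpose_mat P = 1\<^sub>m n"
    by (rule eq_matI) (use P in \<open>auto simp: row orth\<close>)
  \<comment> \<open>A right inverse of a square matrix is also a left inverse; this replaces an
    argument that \<open>n\<close> orthonormal vectors span.\<close>
  then have PP: "transpose_mat P * P = 1\<^sub>m n"
    using mat_mult_left_right_inverse[OF P, of "transpose_mat P"] P by auto
  have Pv: "(P *\<^sub>v z) $ i = u i \<bullet> z" if "i < n" for z i
    using that P by (simp add: row)
  have "x \<bullet> y = x \<bullet> ((transpose_mat P * P) *\<^sub>v y)"
    using y by (simp add: PP)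
  also have "\<dots> = x \<bullet> (transpose_mat P *\<^sub>v (P *\<^sub>v y))"
    using P y by (subst assoc_mult_mat_vec[of _ n n _ n]) auto
  also have "\<dots> = (P *\<^sub>v x) \<bullet> (P *\<^sub>v y)"
  proof -
    have "P *\<^sub>v y \<in> carrier_vec n" using P y by auto
    then show ?thesis
      using transpose_vec_mult_scalar[OF P x, of "P *\<^sub>v y"] P x
      by (simp add: comm_scalar_prod[of x n] comm_scalar_prod[of "P *\<^sub>v x" n])
  qed
  also have "\<dots> = (\<Sum>i<n. (u i \<bullet> x) * (u i \<bullet> y))"
    using P by (auto simp: scalar_prod_def[of "P *\<^sub>v x"] lessThan_atLeast0 Pv row intro!: sum.cong)
  finally show ?thesis .
qed

text \<open>The characteristic polynomial has a complex root \<open>l\<close>. For an eigenvector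
  \<open>v\<close> the Hermitian form \<open>q\<close> equals \<open>l * r\<close> and is its own
  conjugate, while \<open>r\<close>, the squared norm of \<open>v\<close>, is real and nonzero.
  Hence \<open>l\<close> is real.\<close>

lemma real_symmetric_eigenvalue_exists:
  fixes A :: "real mat"
  assumes A: "A \<in> carrier_mat n n" and sym: "transpose_mat A = A" and n: "n \<noteq> 0"
  shows "\<exists>e. eigenvalue A e"
proof -
  let ?c = "complex_of_real"
  let ?A = "map_mat ?c A"
  have cA: "?A \<in> carrier_mat n n" using A by auto
  have "degree (char_poly ?A) \<noteq> 0"
    using degree_monic_char_poly[OF cA] n by auto
  then obtain l where l: "poly (char_poly ?A) l = 0"
    using fundamental_theorem_of_algebra[of "char_poly ?A"] by (auto simp: constant_degree)
  then have "eigenvalue ?A l" using eigenvalue_root_char_poly[OF cA] by auto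
  then obtain v where v: "v \<in> carrier_vec n" "v \<noteq> 0\<^sub>v n" "?A *\<^sub>v v = l \<cdot>\<^sub>v v"
    using cA by (auto simp: eigenvalue_def eigenvector_def)
  define q where "q = (\<Sum>i<n. \<Sum>j<n. ?c (A $$ (i, j)) * v $ j * cnj (v $ i))"
  define r where "r = (\<Sum>i<n. v $ i * cnj (v $ i))"
  have symA: "A $$ (i, j) = A $$ (j, i)" if "i < n" "j < n" for i j
    using sym A that by (metis carrier_matD index_transpose_mat(1))
  have "q = (\<Sum>i<n. (?A *\<^sub>v v) $ i * cnj (v $ i))"
    unfolding q_def using A v(1)
    by (intro sum.cong refl)
       (auto simp: scalar_prod_def lessThan_atLeast0 sum_distrib_right intro!: sum.cong)
  also have "\<dots> = l * r"
    unfolding v(3) using v(1) by (auto simp: r_def sum_distrib_left intro!: sum.cong)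
  finally have q: "q = l * r" .
  have "cnj q = (\<Sum>i<n. \<Sum>j<n. ?c (A $$ (i, j)) * v $ i * cnj (v $ j))"
    by (simp add: q_def mult_ac)
  also have "\<dots> = q"
    unfolding q_def by (subst sum.swap) (auto intro!: sum.cong simp: symA)
  finally have cq: "cnj q = q" .
  have r_real: "r = ?c (\<Sum>i<n. (cmod (v $ i))\<^sup>2)"
    unfolding r_def of_real_sum by (intro sum.cong refl complex_norm_square[symmetric, folded of_real_power])
  obtain i where "i < n" "v $ i \<noteq> 0"
    using v(1,2) by (metis carrier_vecD eq_vecI index_zero_vec)
  then have "(\<Sum>i<n. (cmod (v $ i))\<^sup>2) > 0"
    by (intro sum_pos2[of _ i]) auto
  then have r0: "r \<noteq> 0" and cr: "cnj r = r"
    unfolding r_real by (auto simp del: of_real_sum)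
  have "cnj l = l" using cq r0 cr unfolding q by simp
  then obtain x where x: "l = ?c x"
    by (metis Reals_cnj_iff Reals_cases)
  have "char_poly ?A = map_poly ?c (char_poly A)"
    using of_real_hom.char_poly_hom[OF A] by simp
  then have "?c (poly (char_poly A) x) = 0"
    using l unfolding x by simp
  then show ?thesis
    using eigenvalue_root_char_poly[OF A] by auto
qed

text \<open>Gram-Schmidt keeps the first vector of a completed basis, and normalisation does not
  change it because it already has length 1. This supplies the orthogonal complement for the
  deflation in the spectral theorem.\<close>

lemma orthonormal_basis_extending:
  fixes v :: "real vec"
  assumes v: "v \<in> carrier_vec n" "v \<bullet> v = 1" and n: "n \<noteq> 0"
  shows "\<exists>w. w 0 = v \<and> (\<forall>i<n. w i \<in> carrier_vec n) \<and>
           (\<forall>i<n. \<forall>j<n. w i \<bullet> w j = (if i = j then 1 else 0))"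
proof -
  interpret cof_vec_space n "TYPE(real)" .
  have v0: "v \<noteq> 0\<^sub>v n" using v by auto
  define b where "b = basis_completion v"
  note b = basis_completion[OF v(1) v0, folded b_def]
  define ws where "ws = gram_schmidt n b"
  obtain vs where bv: "b = v # vs" using b(6,7) n by (cases b) auto
  note gs = gram_schmidt_result[OF b(2) b(4) b(5) refl, folded ws_def]
  have hd: "hd ws = v"
    using gram_schmidt_hd[OF v(1), of vs] by (simp add: ws_def bv)
  have len: "length ws = n" using gs b by simp
  have cj: "conjugate x = x" for x :: "real vec"
    by (intro eq_vecI) auto
  have orth: "ws ! i \<bullet> ws ! j = 0 \<longleftrightarrow> i \<noteq> j" if "i < n" "j < n" for i j
    using corthogonalD[OF gs(2), of i j] that len by (simp add: cj)
  have wc: "ws ! i \<in> carrier_vec n" if "i < n" for i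
    using gs(3) len that by (metis nth_mem subsetD)
  have pos: "ws ! i \<bullet> ws ! i > 0" if "i < n" for i
    using orth[OF that that] by (simp add: scalar_prod_def sum_nonneg less_le)
  define w where "w i = (1 / sqrt (ws ! i \<bullet> ws ! i)) \<cdot>\<^sub>v ws ! i" for i
  have "w 0 = v"
    using hd len n v(2) by (cases ws) (auto simp: w_def)
  moreover have "w i \<in> carrier_vec n" if "i < n" for i
    using wc[OF that] by (simp add: w_def)
  moreover have "w i \<bullet> w j = (if i = j then 1 else 0)" if "i < n" "j < n" for i j
    using wc[OF that(1)] wc[OF that(2)] orth[OF that] pos[OF that(1)] by (auto simp: w_def)
  ultimately show ?thesis by blast
qed

text \<open>Deflation: the columns of \<open>W\<close> span the orthogonal complement of one unit
  eigenvector \<open>v\<close>. The compression \<open>B\<close> of \<open>A\<close> to that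
  complement is again symmetric, and \<open>W\<close> lifts its eigenvectors back.\<close>

theorem real_symmetric_spectral:
  fixes A :: "real mat"
  assumes "A \<in> carrier_mat n n" "transpose_mat A = A"
  shows "\<exists>u lam. (\<forall>i<n. u i \<in> carrier_vec n \<and> A *\<^sub>v u i = lam i \<cdot>\<^sub>v u i) \<and>
           (\<forall>i<n. \<forall>j<n. u i \<bullet> u j = (if i = j then 1 else 0))"
  using assms
proof (induction n arbitrary: A)
  case 0
  then show ?case by auto
next
  case (Suc n)
  note A = Suc.prems(1) and sym = Suc.prems(2)
  obtain e where "eigenvalue A e"
    using real_symmetric_eigenvalue_exists[OF A sym] by auto
  then obtain v0 where v0: "v0 \<in> carrier_vec (Suc n)" "v0 \<noteq> 0\<^sub>v (Suc n)" "A *\<^sub>v v0 = e \<cdot>\<^sub>v v0"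
    using A by (auto simp: eigenvalue_def eigenvector_def)
  have sp: "v0 \<bullet> v0 > 0"
    using v0(1,2) conjugate_square_greater_0_vec[of v0 "Suc n"] by auto
  define v where "v = (1 / sqrt (v0 \<bullet> v0)) \<cdot>\<^sub>v v0"
  have v: "v \<in> carrier_vec (Suc n)" and vv: "v \<bullet> v = 1"
    using v0 sp by (auto simp: v_def)
  have Av: "A *\<^sub>v v = e \<cdot>\<^sub>v v"
    unfolding v_def using A v0 by (simp add: mult_mat_vec smult_smult_assoc mult.commute)
  obtain w where w0: "w 0 = v" and w: "\<And>i. i < Suc n \<Longrightarrow> w i \<in> carrier_vec (Suc n)"
    and ww: "\<And>i j. i < Suc n \<Longrightarrow> j < Suc n \<Longrightarrow> w i \<bullet> w j = (if i = j then 1 else 0)"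
    using orthonormal_basis_extending[OF v vv] by auto
  have selfadj: "x \<bullet> (A *\<^sub>v y) = (A *\<^sub>v x) \<bullet> y"
    if "x \<in> carrier_vec (Suc n)" "y \<in> carrier_vec (Suc n)" for x y
    using transpose_vec_mult_scalar[OF A that(2,1)] sym by simp
  define W where "W = mat (Suc n) n (\<lambda>(l, j). w (Suc j) $ l)"
  have W: "W \<in> carrier_mat (Suc n) n" by (simp add: W_def)
  have colW: "col W j = w (Suc j)" if "j < n" for j
    using w[of "Suc j"] that by (auto simp: W_def)
  have WW: "transpose_mat W * W = 1\<^sub>m n"
    by (rule eq_matI) (use W in \<open>auto simp: colW ww\<close>)
  have Wx: "W *\<^sub>v x \<in> carrier_vec (Suc n)" if "x \<in> carrier_vec n" for x
    using W that by auto
  have wW: "w (Suc j) \<bullet> (W *\<^sub>v x) = x $ j" if "j < n" "x \<in> carrier_vec n" for j x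
  proof -
    have "w (Suc j) \<bullet> (W *\<^sub>v x) = (transpose_mat W *\<^sub>v (W *\<^sub>v x)) $ j"
      using that W by (simp add: colW)
    also have "\<dots> = ((transpose_mat W * W) *\<^sub>v x) $ j"
      using that W by (subst assoc_mult_mat_vec[of _ n "Suc n" _ n]) auto
    finally show ?thesis using that by (simp add: WW)
  qed
  have vW: "v \<bullet> (W *\<^sub>v x) = 0" if "x \<in> carrier_vec n" for x
  proof -
    have "transpose_mat W *\<^sub>v v = 0\<^sub>v n"
      by (rule eq_vecI) (use W v ww[of "Suc _" 0] in \<open>auto simp: colW w0\<close>)
    then have "(transpose_mat W *\<^sub>v v) \<bullet> x = 0" using that by simp
    then show ?thesis
      using transpose_vec_mult_scalar[OF W that v] by simp
  qed
  have WWs: "(W *\<^sub>v x) \<bullet> (W *\<^sub>v y) = x \<bullet> y" if "x \<in> carrier_vec n" "y \<in> carrier_vec n" for x y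
  proof -
    have "(W *\<^sub>v x) \<bullet> (W *\<^sub>v y) = (transpose_mat W *\<^sub>v (W *\<^sub>v x)) \<bullet> y"
      using transpose_vec_mult_scalar[OF W that(2) Wx[OF that(1)]] by simp
    also have "transpose_mat W *\<^sub>v (W *\<^sub>v x) = (transpose_mat W * W) *\<^sub>v x"
      using that W by (subst assoc_mult_mat_vec[of _ n "Suc n" _ n]) auto
    finally show ?thesis using that by (simp add: WW)
  qed
  define B where "B = transpose_mat W * (A * W)"
  have B: "B \<in> carrier_mat n n" using W A by (simp add: B_def)
  have "transpose_mat B = transpose_mat (A * W) * W"
    unfolding B_def using W A by (subst transpose_mult[of _ n "Suc n" _ n]) auto
  also have "\<dots> = (transpose_mat W * A) * W"
    using W A sym by (subst transpose_mult[of _ "Suc n" "Suc n" _ n]) auto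
  also have "\<dots> = B"
    unfolding B_def using W A by (subst assoc_mult_mat[of _ n "Suc n" _ "Suc n" _ n]) auto
  finally have symB: "transpose_mat B = B" .
  obtain u lam where u: "\<And>i. i < n \<Longrightarrow> u i \<in> carrier_vec n"
    and Bu: "\<And>i. i < n \<Longrightarrow> B *\<^sub>v u i = lam i \<cdot>\<^sub>v u i"
    and uu: "\<And>i j. i < n \<Longrightarrow> j < n \<Longrightarrow> u i \<bullet> u j = (if i = j then 1 else 0)"
    using Suc.IH[OF B symB] by blast
  \<comment> \<open>\<open>W * transpose_mat W\<close> is not the identity, so the two sides are
    compared through their inner products with the basis \<open>w\<close>. Along \<open>v\<close>
    both vanish because \<open>A\<close> is self-adjoint; along the other basis vectors the claim is
    the eigenvector equation of \<open>B\<close>.\<close>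
  have AW: "A *\<^sub>v (W *\<^sub>v u i) = lam i \<cdot>\<^sub>v (W *\<^sub>v u i)" (is "?l = ?r") if i: "i < n" for i
  proof -
    have c: "?l \<in> carrier_vec (Suc n)" "?r \<in> carrier_vec (Suc n)"
      using A Wx[OF u[OF i]] by auto
    have "w j \<bullet> ?l = w j \<bullet> ?r" if j: "j < Suc n" for j
    proof (cases j)
      case 0
      have "v \<bullet> ?l = (e \<cdot>\<^sub>v v) \<bullet> (W *\<^sub>v u i)"
        using selfadj[OF v Wx[OF u[OF i]]] by (simp add: Av)
      then show ?thesis
        using v Wx[OF u[OF i]] vW[OF u[OF i]] by (simp add: 0 w0)
    next
      case (Suc m)
      then have m: "m < n" using j by simp
      have "w j \<bullet> ?l = (transpose_mat W *\<^sub>v (A *\<^sub>v (W *\<^sub>v u i))) $ m"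
        using W m by (simp add: colW Suc)
      also have "transpose_mat W *\<^sub>v (A *\<^sub>v (W *\<^sub>v u i)) = B *\<^sub>v u i"
        unfolding B_def using A W u[OF i]
        by (simp add: assoc_mult_mat_vec[of _ n "Suc n" _ n] assoc_mult_mat_vec[of _ "Suc n" "Suc n" _ n])
      also have "(B *\<^sub>v u i) $ m = lam i * u i $ m"
        using u[OF i] m by (simp add: Bu[OF i])
      also have "\<dots> = w j \<bullet> ?r"
        using wW[OF m u[OF i]] w[OF j] Wx[OF u[OF i]] by (simp add: Suc)
      finally show ?thesis .
    qed
    then have "z \<bullet> ?l = z \<bullet> ?r" if "z \<in> carrier_vec (Suc n)" for z
      using orthonormal_parseval[of "Suc n" w z ?l] orthonormal_parseval[of "Suc n" w z ?r] w ww c that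
      by auto
    then have "?l $ j = ?r $ j" if "j < Suc n" for j
      using c that scalar_prod_left_unit by (metis unit_vec_carrier)
    then show ?thesis
      by (intro eq_vecI) (unfold carrier_vecD[OF c(1)] carrier_vecD[OF c(2)], blast, rule refl)
  qed
  let ?u = "\<lambda>i. case i of 0 \<Rightarrow> v | Suc i \<Rightarrow> W *\<^sub>v u i"
  let ?l = "\<lambda>i. case i of 0 \<Rightarrow> e | Suc i \<Rightarrow> lam i"
  have "?u i \<in> carrier_vec (Suc n) \<and> A *\<^sub>v ?u i = ?l i \<cdot>\<^sub>v ?u i" if "i < Suc n" for i
    using that v Av AW Wx u by (cases i) auto
  moreover have "?u i \<bullet> ?u j = (if i = j then 1 else 0)" if ij: "i < Suc n" "j < Suc n" for i j
  proof (cases i; cases j)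
    fix i' assume i: "i = Suc i'" and j: "j = 0"
    have "(W *\<^sub>v u i') \<bullet> v = v \<bullet> (W *\<^sub>v u i')"
      using ij i by (intro comm_scalar_prod[of _ "Suc n"] Wx u v) auto
    then show ?thesis using ij i j vW[OF u, of i'] by simp
  qed (use ij vv vW[OF u] WWs[OF u u] uu in auto)
  ultimately show ?case by (intro exI[of _ ?u] exI[of _ ?l]) blast
qed

text \<open>\<open>mu\<close> is read off the roots of the characteristic polynomial with
  multiplicity. Similarity to a diagonal matrix identifies these with the \<open>lam i\<close>,
  repetitions included, so that counting eigenvectors counts eigenvalues.\<close>

lemma char_poly_orthonormal_eigenbasis:
  fixes A :: "real mat"
  assumes A: "A \<in> carrier_mat n n"
    and u: "\<And>i. i < n \<Longrightarrow> u i \<in> carrier_vec n"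
    and Au: "\<And>i. i < n \<Longrightarrow> A *\<^sub>v u i = lam i \<cdot>\<^sub>v u i"
    and orth: "\<And>i j. i < n \<Longrightarrow> j < n \<Longrightarrow> u i \<bullet> u j = (if i = j then 1 else 0)"
  shows "char_poly A = (\<Prod>i<n. [:- lam i, 1:])"
proof -
  define U where "U = mat n n (\<lambda>(l, i). u i $ l)"
  define D where "D = mat n n (\<lambda>(i, j). if i = j then lam i else 0)"
  have U: "U \<in> carrier_mat n n" and D: "D \<in> carrier_mat n n" by (simp_all add: U_def D_def)
  have col: "col U i = u i" if "i < n" for i
    using u[OF that] that by (auto simp: U_def)
  have UU: "transpose_mat U * U = 1\<^sub>m n"
    by (rule eq_matI) (use U in \<open>auto simp: col orth\<close>)
  have UU': "U * transpose_mat U = 1\<^sub>m n"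
    using mat_mult_left_right_inverse[OF _ U UU] U by auto
  have "transpose_mat U * A * U = D"
  proof (rule eq_matI)
    fix i j assume "i < dim_row D" "j < dim_col D"
    then have ij: "i < n" "j < n" using D by auto
    have "(transpose_mat U * A * U) $$ (i, j) = (transpose_mat U * (A * U)) $$ (i, j)"
      using U A by (subst assoc_mult_mat[of _ n n _ n _ n]) auto
    also have "\<dots> = row (transpose_mat U) i \<bullet> col (A * U) j"
      using U A ij by (intro index_mult_mat) auto
    also have "\<dots> = u i \<bullet> (A *\<^sub>v u j)"
      using U ij by (simp add: col_mult2[OF A U ij(2)] col)
    also have "\<dots> = D $$ (i, j)"
      using ij u[OF ij(1)] u[OF ij(2)] by (auto simp: Au orth D_def)
    finally show "(transpose_mat U * A * U) $$ (i, j) = D $$ (i, j)" .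
  qed (use U A D in auto)
  then have "similar_mat_wit D A (transpose_mat U) U"
    using U A D UU UU' by (intro similar_mat_witI[of _ _ n]) auto
  then have "char_poly A = char_poly D"
    by (metis char_poly_similar similar_mat_def)
  also have "\<dots> = (\<Prod>a\<leftarrow>diag_mat D. [:- a, 1:])"
    by (rule char_poly_upper_triangular[OF D]) (auto simp: D_def upper_triangular_def)
  also have "diag_mat D = map lam [0..<n]"
    unfolding diag_mat_def using D by (auto simp: D_def intro!: map_cong)
  also have "(\<Prod>a\<leftarrow>map lam [0..<n]. [:- a, 1:]) = (\<Prod>i<n. [:- lam i, 1:])"
    using prod.distinct_set_conv_list[of "[0..<n]" "\<lambda>i. [:- lam i, 1:]"]
    by (simp add: lessThan_atLeast0 o_def)
  finally show ?thesis .
qed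

section \<open>Dimension counting and the min-max principle\<close>

lemma kernel_vector_exists:
  fixes f :: "nat \<Rightarrow> 'a :: field vec"
  assumes f: "\<And>i. i < m \<Longrightarrow> f i \<in> carrier_vec h" and m: "m < h"
  shows "\<exists>x\<in>carrier_vec h. x \<noteq> 0\<^sub>v h \<and> (\<forall>i<m. f i \<bullet> x = 0)"
proof -
  \<comment> \<open>The \<open>m\<close> vectors are padded by zero rows to a square matrix. Since
    \<open>m < h\<close>, row \<open>m\<close> is zero, so the determinant vanishes and a kernel
    vector exists.\<close>
  define R where "R = mat h h (\<lambda>(i, j). if i < m then f i $ j else 0)"
  have R: "R \<in> carrier_mat h h" by (simp add: R_def)
  have "transpose_mat R *\<^sub>v unit_vec h m = 0\<^sub>v h"
    using R m by (intro eq_vecI) (auto simp: R_def)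
  then have "Determinant.det (transpose_mat R) = 0"
    using det_0_iff_vec_prod_zero_field[of "transpose_mat R" h] R m
    by (metis transpose_carrier_mat unit_vec_carrier unit_vec_nonzero)
  then have "Determinant.det R = 0" using Determinant.det_transpose[OF R] by simp
  then obtain x where x: "x \<in> carrier_vec h" "x \<noteq> 0\<^sub>v h" "R *\<^sub>v x = 0\<^sub>v h"
    using det_0_iff_vec_prod_zero_field[OF R] by auto
  have "f i \<bullet> x = 0" if i: "i < m" for i
  proof -
    have "row R i = f i" using f[OF i] i m by (auto simp: R_def)
    then have "f i \<bullet> x = (R *\<^sub>v x) $ i" using R i m by simp
    then show ?thesis using i m x by simp
  qed
  then show ?thesis using x by blast
qed

text \<open>If the entry at position \<open>h - 1\<close> were below \<open>c\<close>, so would be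
  all later entries of the descending list, leaving at most \<open>h - 1\<close> entries that reach
  \<open>c\<close>.\<close>

lemma rev_sorted_list_nth_ge:
  fixes M :: "'a :: linorder multiset"
  assumes h: "h \<ge> 1" and card: "size (filter_mset (\<lambda>x. c \<le> x) M) \<ge> h"
  shows "c \<le> rev (sorted_list_of_multiset M) ! (h - 1)"
proof (rule ccontr)
  assume neg: "\<not> c \<le> rev (sorted_list_of_multiset M) ! (h - 1)"
  define xs where "xs = rev (sorted_list_of_multiset M)"
  have xs: "mset xs = M" "sorted (rev xs)" by (auto simp: xs_def)
  have sz: "h \<le> length xs"
    using card size_filter_mset_lesseq[of "\<lambda>x. c \<le> x" M] by (simp flip: xs(1))
  have "filter (\<lambda>x. c \<le> x) (drop (h - 1) xs) = []"
  proof -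
    have "x < c" if x: "x \<in> set (drop (h - 1) xs)" for x
    proof -
      obtain j where "j < length xs - (h - 1)" "x = xs ! (h - 1 + j)"
        using x sz by (auto simp: in_set_conv_nth)
      then have j: "h - 1 + j < length xs" "x = xs ! (h - 1 + j)" by auto
      have "xs ! (h - 1 + j) \<le> xs ! (h - 1)"
        using sorted_rev_nth_mono[OF xs(2), of "h - 1" "h - 1 + j"] j by simp
      then show ?thesis using neg j by (simp add: xs_def)
    qed
    then show ?thesis by (auto simp: filter_empty_conv not_le)
  qed
  then have "filter (\<lambda>x. c \<le> x) xs = filter (\<lambda>x. c \<le> x) (take (h - 1) xs)"
    by (metis append_Nil2 append_take_drop_id filter_append)
  then have "length (filter (\<lambda>x. c \<le> x) xs) \<le> h - 1"
    using length_filter_le[of "\<lambda>x. c \<le> x" "take (h - 1) xs"] by simp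
  moreover have "size (filter_mset (\<lambda>x. c \<le> x) M) = length (filter (\<lambda>x. c \<le> x) xs)"
    by (metis mset_filter size_mset xs(1))
  ultimately show False using card h by simp
qed

text \<open>The lower half of the Courant--Fischer principle, for the test space \<open>M *\<^sub>v \<real>\<^sup>h\<close>.\<close>

lemma mu_ge:
  assumes B: "B \<in> carrier_mat s s" and sym: "transpose_mat B = B" and h: "h \<ge> 1"
    and M: "M \<in> carrier_mat s h"
    and nonzero: "\<And>a. a \<in> carrier_vec h \<Longrightarrow> a \<noteq> 0\<^sub>v h \<Longrightarrow> M *\<^sub>v a \<noteq> 0\<^sub>v s"
    and ray: "\<And>a. a \<in> carrier_vec h \<Longrightarrow>
      (M *\<^sub>v a) \<bullet> (B *\<^sub>v (M *\<^sub>v a)) \<ge> c * ((M *\<^sub>v a) \<bullet> (M *\<^sub>v a))"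
  shows "mu h B \<ge> c"
proof -
  obtain u lam where u: "\<And>i. i < s \<Longrightarrow> u i \<in> carrier_vec s"
    and Bu: "\<And>i. i < s \<Longrightarrow> B *\<^sub>v u i = lam i \<cdot>\<^sub>v u i"
    and uu: "\<And>i j. i < s \<Longrightarrow> j < s \<Longrightarrow> u i \<bullet> u j = (if i = j then 1 else 0)"
    using real_symmetric_spectral[OF B sym] by blast
  have "eigenvalues_mset B = (\<Sum>i<s. {#lam i#})"
    unfolding eigenvalues_mset_def char_poly_orthonormal_eigenbasis[OF B u Bu uu, simplified]
    by (subst proots_prod) auto
  also have "\<dots> = image_mset lam (mset_set {..<s})"
    by (induction s) (auto simp: lessThan_Suc)
  finally have ev: "eigenvalues_mset B = image_mset lam (mset_set {..<s})" .
  define S where "S = {i. i < s \<and> c \<le> lam i}"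
  \<comment> \<open>Otherwise fewer than \<open>h\<close> linear conditions on \<open>a\<close> make
    \<open>M *\<^sub>v a\<close> orthogonal to every eigenvector with eigenvalue at least
    \<open>c\<close>, and that nonzero vector violates \<open>ray\<close>.\<close>
  have "card S \<ge> h"
  proof (rule ccontr)
    assume "\<not> card S \<ge> h"
    then have less: "card S < h" by simp
    have "finite S" by (simp add: S_def)
    then obtain g where g: "bij_betw g {..<card S} S"
      by (metis ex_bij_betw_nat_finite lessThan_atLeast0)
    have gS: "g i \<in> S" if "i < card S" for i
      using g that by (auto simp: bij_betw_def)
    have gs: "g i < s" if "i < card S" for i
      using gS[OF that] by (simp add: S_def)
    obtain a where a: "a \<in> carrier_vec h" "a \<noteq> 0\<^sub>v h"
      and a0: "\<And>i. i < card S \<Longrightarrow> (transpose_mat M *\<^sub>v u (g i)) \<bullet> a = 0"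
      using kernel_vector_exists[OF _ less, of "\<lambda>i. transpose_mat M *\<^sub>v u (g i)"] M
      by (metis mult_mat_vec_carrier gs transpose_carrier_mat u)
    define y where "y = M *\<^sub>v a"
    have y: "y \<in> carrier_vec s" using M a by (simp add: y_def)
    have y0: "u i \<bullet> y = 0" if i: "i \<in> S" for i
    proof -
      obtain j where j: "j < card S" "i = g j" using g i by (auto simp: bij_betw_def)
      show ?thesis
        using a0[OF j(1)] transpose_vec_mult_scalar[OF M a(1) u[OF gs[OF j(1)]]] by (simp add: j y_def)
    qed
    have "y \<noteq> 0\<^sub>v s" using nonzero[OF a] by (simp add: y_def)
    then have pos: "y \<bullet> y > 0"
      using conjugate_square_greater_0_vec[OF y] by simp
    have By: "B *\<^sub>v y \<in> carrier_vec s" using B y by simp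
    have uB: "u i \<bullet> (B *\<^sub>v y) = lam i * (u i \<bullet> y)" if "i < s" for i
      using transpose_vec_mult_scalar[OF B y u[OF that]] sym Bu[OF that] u[OF that] y by simp
    have "y \<bullet> (B *\<^sub>v y) = (\<Sum>i<s. lam i * (u i \<bullet> y)\<^sup>2)"
      using orthonormal_parseval[OF u uu y By] by (auto simp: uB power2_eq_square intro!: sum.cong)
    \<comment> \<open>Strictness comes from \<open>y\<close> being nonzero: some coordinate of
      \<open>y\<close> in the eigenbasis is nonzero, and it must belong to an eigenvalue strictly
      below \<open>c\<close>.\<close>
    moreover have "(\<Sum>i<s. lam i * (u i \<bullet> y)\<^sup>2) < (\<Sum>i<s. c * (u i \<bullet> y)\<^sup>2)"
    proof (rule sum_strict_mono_ex1)
      show "\<forall>i\<in>{..<s}. lam i * (u i \<bullet> y)\<^sup>2 \<le> c * (u i \<bullet> y)\<^sup>2"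
      proof
        fix i assume "i \<in> {..<s}"
        then show "lam i * (u i \<bullet> y)\<^sup>2 \<le> c * (u i \<bullet> y)\<^sup>2"
          using y0[of i] by (cases "i \<in> S") (auto simp: S_def mult_right_mono)
      qed
      have "\<exists>i<s. u i \<bullet> y \<noteq> 0"
        using pos orthonormal_parseval[OF u uu y y] by (metis (no_types, lifting) less_irrefl lessThan_iff mult_zero_left sum.neutral)
      then obtain i where i: "i < s" "u i \<bullet> y \<noteq> 0" by blast
      then have "lam i < c" using y0[of i] by (metis (mono_tags, lifting) S_def mem_Collect_eq not_le)
      then show "\<exists>i\<in>{..<s}. lam i * (u i \<bullet> y)\<^sup>2 < c * (u i \<bullet> y)\<^sup>2"
        using i by (intro bexI[of _ i]) auto
    qed simp
    moreover have "(\<Sum>i<s. c * (u i \<bullet> y)\<^sup>2) = c * (y \<bullet> y)"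
      using orthonormal_parseval[OF u uu y y] by (simp add: sum_distrib_left power2_eq_square)
    ultimately show False using ray[OF a(1)] by (simp add: y_def)
  qed
  moreover have "size (filter_mset (\<lambda>x. c \<le> x) (eigenvalues_mset B)) = card S"
    by (simp add: ev filter_mset_image_mset S_def)
  ultimately show ?thesis
    unfolding mu_def by (intro rev_sorted_list_nth_ge h) simp
qed

section \<open>Random walks and step functions\<close>

declare sum_of_bool_mult_eq [simp del] sum_mult_of_bool_eq [simp del]

section \<open>The symmetric walk matrix and its Dirichlet form\<close>

lemma real_deg_eq_sum: "real (deg n E v) = (\<Sum>w<n. of_bool (E v w))"
proof -
  have "{u. u < n \<and> E v u} = {u \<in> {..<n}. E v u}" by auto
  then show ?thesis by (simp add: deg_def of_bool_def sum.If_cases Int_def)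
qed

text \<open>The matrix N of the overview, given entrywise. It is the lazy walk conjugated by the
  square roots of the degrees, which makes it symmetric and gives access to the spectral
  theorem.\<close>

definition norm_walk :: "nat \<Rightarrow> (nat \<Rightarrow> nat \<Rightarrow> bool) \<Rightarrow> real mat" where
  "norm_walk n E = mat n n (\<lambda>(u, v).
     (of_bool (u = v) + of_bool (E u v) / (sqrt (deg n E u) * sqrt (deg n E v))) / 2)"

lemma norm_walk_carrier [simp]: "norm_walk n E \<in> carrier_mat n n"
  by (simp add: norm_walk_def)

lemma norm_walk_symmetric:
  assumes "simple_graph n E"
  shows "transpose_mat (norm_walk n E) = norm_walk n E"
  using assms by (intro eq_matI) (auto simp: norm_walk_def simple_graph_def of_bool_def)

text \<open>With \<open>a\<close> and \<open>b\<close> the sums of \<open>(f u)\<^sup>2\<close> and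
  of \<open>f u * f v\<close> over ordered adjacent pairs, the left side is
  \<open>(a - b) / 2\<close>, the half being the laziness, while the double sum of squares is
  \<open>2 * a - 2 * b\<close>. Hence the quarter.\<close>

lemma norm_walk_dirichlet_form:
  fixes f :: "nat \<Rightarrow> real"
  assumes G: "simple_graph n E" and deg1: "\<forall>v<n. deg n E v \<ge> 1"
  defines "x \<equiv> vec n (\<lambda>v. f v * sqrt (deg n E v))"
  shows "x \<bullet> x - x \<bullet> (norm_walk n E *\<^sub>v x) = (\<Sum>u<n. \<Sum>v<n. of_bool (E u v) * (f u - f v)\<^sup>2) / 4"
proof -
  have sym: "E u v \<longleftrightarrow> E v u" for u v using G by (auto simp: simple_graph_def)
  have pos: "sqrt (deg n E v) > 0" if "v < n" for v using deg1 that by force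
  define a where "a = (\<Sum>u<n. \<Sum>v<n. of_bool (E u v) * (f u)\<^sup>2)"
  define b where "b = (\<Sum>u<n. \<Sum>v<n. of_bool (E u v) * (f u * f v))"
  have xx: "x \<bullet> x = a"
    by (simp add: scalar_prod_def x_def a_def lessThan_atLeast0 real_deg_eq_sum power2_eq_square
        sum_distrib_left mult_ac flip: real_sqrt_mult)
       (simp add: mult_ac flip: sum_distrib_left)
  have Nx: "(norm_walk n E *\<^sub>v x) $ u = x $ u / 2 + (\<Sum>v<n. of_bool (E u v) * f v) / (2 * sqrt (deg n E u))"
    if u: "u < n" for u
  proof -
    have gen: "(d + e / (p * q)) / 2 * (c * q) = d * (c * q) / 2 + e * c / (2 * p)"
      if "p > 0" "q > 0" for c d e p q :: real
      using that by (simp add: field_simps)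
    have "(norm_walk n E *\<^sub>v x) $ u =
        (\<Sum>v<n. (of_bool (u = v) + of_bool (E u v) / (sqrt (deg n E u) * sqrt (deg n E v))) / 2
          * (f v * sqrt (deg n E v)))"
      using u by (simp add: norm_walk_def scalar_prod_def x_def lessThan_atLeast0)
    also have "\<dots> = (\<Sum>v<n. (if v = u then x $ u / 2 else 0)
        + of_bool (E u v) * f v / (2 * sqrt (deg n E u)))"
    proof (intro sum.cong refl)
      fix v assume "v \<in> {..<n}"
      then have "sqrt (deg n E v) > 0" by (simp add: pos del: real_sqrt_gt_0_iff)
      then show "(of_bool (u = v) + of_bool (E u v) / (sqrt (deg n E u) * sqrt (deg n E v))) / 2
            * (f v * sqrt (deg n E v))
          = (if v = u then x $ u / 2 else 0) + of_bool (E u v) * f v / (2 * sqrt (deg n E u))"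
        using u gen[OF pos[OF u], of "sqrt (deg n E v)" "of_bool (u = v)" "of_bool (E u v)" "f v"]
        by (cases "u = v") (simp_all add: x_def)
    qed
    also have "\<dots> = x $ u / 2 + (\<Sum>v<n. of_bool (E u v) * f v) / (2 * sqrt (deg n E u))"
      using u by (simp add: sum.distrib sum_divide_distrib)
    finally show ?thesis .
  qed
  have dimN: "dim_vec (norm_walk n E *\<^sub>v x) = n" by (simp add: norm_walk_def)
  have "x \<bullet> (norm_walk n E *\<^sub>v x) =
      (\<Sum>u<n. x $ u * (x $ u / 2 + (\<Sum>v<n. of_bool (E u v) * f v) / (2 * sqrt (deg n E u))))"
    unfolding scalar_prod_def[of x "norm_walk n E *\<^sub>v x"] dimN lessThan_atLeast0[symmetric]
    by (intro sum.cong refl) (simp only: Nx lessThan_iff)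
  also have "\<dots> = (\<Sum>u<n. x $ u * x $ u / 2 + (\<Sum>v<n. of_bool (E u v) * (f u * f v)) / 2)"
    using pos by (intro sum.cong refl)
      (simp add: x_def field_simps sum_distrib_left sum_distrib_right mult_ac)
  also have "\<dots> = a / 2 + b / 2"
    unfolding xx[symmetric] b_def
    by (simp add: sum.distrib sum_divide_distrib scalar_prod_def lessThan_atLeast0 x_def)
  finally have xN: "x \<bullet> (norm_walk n E *\<^sub>v x) = a / 2 + b / 2" .
  have a': "a = (\<Sum>u<n. \<Sum>v<n. of_bool (E u v) * (f v)\<^sup>2)"
    unfolding a_def by (subst sum.swap) (simp add: sym)
  have "(\<Sum>u<n. \<Sum>v<n. of_bool (E u v) * (f u - f v)\<^sup>2)
      = (\<Sum>u<n. \<Sum>v<n. of_bool (E u v) * (f u)\<^sup>2 + of_bool (E u v) * (f v)\<^sup>2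
          - 2 * (of_bool (E u v) * (f u * f v)))"
    by (simp add: power2_eq_square algebra_simps)
  also have "\<dots> = a + a - 2 * b"
    unfolding sum_subtractf sum.distrib a'[symmetric] by (simp add: a_def b_def sum_distrib_left)
  finally show ?thesis using xx xN by simp
qed

section \<open>Energy of step functions on disjoint sets\<close>

lemma sum_of_bool_disjoint_le_1:
  fixes h :: nat
  assumes "\<forall>i<h. \<forall>j<h. i \<noteq> j \<longrightarrow> C i \<inter> C j = {}"
  shows "(\<Sum>i<h. of_bool (v \<in> C i) :: real) \<le> 1"
proof -
  have "i = j" if "i < h" "v \<in> C i" "j < h" "v \<in> C j" for i j
    using assms that by blast
  then have "card {i. i < h \<and> v \<in> C i} \<le> 1"
    by (auto simp: card_le_Suc0_iff_eq)
  moreover have "{..<h} \<inter> {i. v \<in> C i} = {i. i < h \<and> v \<in> C i}" by auto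
  ultimately show ?thesis by simp
qed

lemma step_function_square:
  fixes \<alpha> :: "nat \<Rightarrow> real"
  assumes disj: "\<forall>i<h. \<forall>j<h. i \<noteq> j \<longrightarrow> C i \<inter> C j = {}"
  shows "(\<Sum>i<h. \<alpha> i * of_bool (v \<in> C i))\<^sup>2 = (\<Sum>i<h. (\<alpha> i)\<^sup>2 * of_bool (v \<in> C i))"
proof -
  have "(\<Sum>i<h. \<alpha> i * of_bool (v \<in> C i))\<^sup>2 =
     (\<Sum>i<h. \<Sum>j<h. (\<alpha> i * of_bool (v \<in> C i)) * (\<alpha> j * of_bool (v \<in> C j)))"
    by (simp only: power2_eq_square sum_product)
  also have "\<dots> = (\<Sum>i<h. \<Sum>j<h. if j = i then (\<alpha> i)\<^sup>2 * of_bool (v \<in> C i) else 0)"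
    using disj by (intro sum.cong refl) (auto simp: power2_eq_square)
  finally show ?thesis by simp
qed

lemma cut_edges_eq_sum:
  assumes "C \<subseteq> {..<n}"
  shows "real (cut_edges n E C) = (\<Sum>u<n. \<Sum>v<n. of_bool (E u v) * (of_bool (u \<in> C) * (1 - of_bool (v \<in> C))))"
proof -
  have "{(u, v). u \<in> C \<and> v < n \<and> v \<notin> C \<and> E u v}
      = {p \<in> {..<n} \<times> {..<n}. fst p \<in> C \<and> snd p \<notin> C \<and> E (fst p) (snd p)}"
    using assms by auto
  then have "real (cut_edges n E C) = (\<Sum>p\<in>{..<n} \<times> {..<n}. of_bool (fst p \<in> C \<and> snd p \<notin> C \<and> E (fst p) (snd p)))"
    by (simp add: cut_edges_def of_bool_def sum.If_cases Int_def)
  also have "\<dots> = (\<Sum>u<n. \<Sum>v<n. of_bool (u \<in> C \<and> v \<notin> C \<and> E u v))"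
    by (simp only: sum.cartesian_product case_prod_unfold)
  also have "\<dots> = (\<Sum>u<n. \<Sum>v<n. of_bool (E u v) * (of_bool (u \<in> C) * (1 - of_bool (v \<in> C))))"
    by (intro sum.cong refl) auto
  finally show ?thesis .
qed

text \<open>The endpoints of an edge lie in at most two of the sets, so Cauchy-Schwarz over
  \<open>i\<close> costs a factor 2. Each cut edge is seen in both orders, which costs another 2.
  The resulting 4 cancels the quarter in \<open>norm_walk_dirichlet_form\<close>.\<close>

lemma dirichlet_form_step_function_le:
  fixes \<alpha> :: "nat \<Rightarrow> real"
  assumes G: "simple_graph n E"
    and sub: "\<forall>i<h. C i \<subseteq> {..<n}" and disj: "\<forall>i<h. \<forall>j<h. i \<noteq> j \<longrightarrow> C i \<inter> C j = {}"
  defines "f \<equiv> \<lambda>v. \<Sum>i<h. \<alpha> i * of_bool (v \<in> C i)"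
  shows "(\<Sum>u<n. \<Sum>v<n. of_bool (E u v) * (f u - f v)\<^sup>2)
      \<le> 4 * (\<Sum>i<h. (\<alpha> i)\<^sup>2 * real (cut_edges n E (C i)))"
proof -
  have sym: "E u v \<longleftrightarrow> E v u" for u v using G by (auto simp: simple_graph_def)
  define g :: "nat \<Rightarrow> nat \<Rightarrow> nat \<Rightarrow> real" where "g i u v = of_bool (u \<in> C i) - of_bool (v \<in> C i)" for i u v
  define c :: "nat \<Rightarrow> nat \<Rightarrow> nat \<Rightarrow> real" where "c i u v = of_bool (u \<in> C i) * (1 - of_bool (v \<in> C i))" for i u v
  have g2: "(g i u v)\<^sup>2 = c i u v + c i v u" for i u v by (auto simp: g_def c_def)
  have le: "(f u - f v)\<^sup>2 \<le> 2 * (\<Sum>i<h. (\<alpha> i)\<^sup>2 * (g i u v)\<^sup>2)" for u v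
  proof -
    \<comment> \<open>\<open>g\<close> takes values in {-1, 0, 1}, so its cube is \<open>g\<close>.
      Splitting off the square makes the second Cauchy-Schwarz factor count the sets that separate
      \<open>u\<close> from \<open>v\<close>.\<close>
    have "f u - f v = (\<Sum>i<h. (\<alpha> i * g i u v) * (g i u v)\<^sup>2)"
      unfolding f_def sum_subtractf[symmetric] by (intro sum.cong refl) (auto simp: g_def)
    then have "(f u - f v)\<^sup>2 \<le> (\<Sum>i<h. (\<alpha> i * g i u v)\<^sup>2) * (\<Sum>i<h. ((g i u v)\<^sup>2)\<^sup>2)"
      using Cauchy_Schwarz_ineq_sum[of "\<lambda>i. \<alpha> i * g i u v" "\<lambda>i. (g i u v)\<^sup>2" "{..<h}"] by (simp only:)
    also have "(\<Sum>i<h. ((g i u v)\<^sup>2)\<^sup>2) \<le> (\<Sum>i<h. of_bool (u \<in> C i) + of_bool (v \<in> C i))"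
      by (intro sum_mono) (auto simp: g_def)
    then have "(\<Sum>i<h. ((g i u v)\<^sup>2)\<^sup>2) \<le> 2"
      using sum_of_bool_disjoint_le_1[OF disj, of u] sum_of_bool_disjoint_le_1[OF disj, of v]
      by (simp add: sum.distrib)
    then have "(\<Sum>i<h. (\<alpha> i * g i u v)\<^sup>2) * (\<Sum>i<h. ((g i u v)\<^sup>2)\<^sup>2) \<le> (\<Sum>i<h. (\<alpha> i * g i u v)\<^sup>2) * 2"
      by (intro mult_left_mono sum_nonneg) auto
    finally show ?thesis by (simp add: power_mult_distrib)
  qed
  have "(\<Sum>u<n. \<Sum>v<n. of_bool (E u v) * (f u - f v)\<^sup>2)
      \<le> (\<Sum>u<n. \<Sum>v<n. of_bool (E u v) * (2 * (\<Sum>i<h. (\<alpha> i)\<^sup>2 * (g i u v)\<^sup>2)))"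
    by (intro sum_mono mult_left_mono le) auto
  also have "\<dots> = 2 * (\<Sum>u<n. \<Sum>v<n. \<Sum>i<h. (\<alpha> i)\<^sup>2 * (of_bool (E u v) * (c i u v + c i v u)))"
    by (simp add: sum_distrib_left g2 mult_ac)
  also have "\<dots> = 2 * (\<Sum>i<h. \<Sum>u<n. \<Sum>v<n. (\<alpha> i)\<^sup>2 * (of_bool (E u v) * (c i u v + c i v u)))"
    by (subst sum.swap, subst (2) sum.swap, simp add: sum.swap[of _ "{..<h}"])
  also have "\<dots> = 2 * (\<Sum>i<h. (\<alpha> i)\<^sup>2 * (2 * real (cut_edges n E (C i))))"
  proof (intro arg_cong2[of _ _ _ _ "(*)"] sum.cong refl)
    fix i assume "i \<in> {..<h}"
    then have i: "C i \<subseteq> {..<n}" using sub by auto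
    have "(\<Sum>u<n. \<Sum>v<n. of_bool (E u v) * c i v u) = (\<Sum>u<n. \<Sum>v<n. of_bool (E u v) * c i u v)"
      by (subst sum.swap) (simp add: sym)
    then have "(\<Sum>u<n. \<Sum>v<n. of_bool (E u v) * (c i u v + c i v u)) = 2 * real (cut_edges n E (C i))"
      by (simp add: cut_edges_eq_sum[OF i] distrib_left sum.distrib flip: c_def)
    then show "(\<Sum>u<n. \<Sum>v<n. (\<alpha> i)\<^sup>2 * (of_bool (E u v) * (c i u v + c i v u))) =
        (\<alpha> i)\<^sup>2 * (2 * real (cut_edges n E (C i)))"
      by (simp flip: sum_distrib_left)
  qed
  finally show ?thesis by (simp add: sum_distrib_left mult_ac)
qed

text \<open>One step suffices: the inverse square root of the degree matrix intertwines the lazy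
  walk with its symmetric form, and powers follow by moving it past one factor at a time.\<close>

lemma deg_inv_sqrt_lazy_walk:
  assumes G: "simple_graph n E" and deg1: "\<forall>v<n. deg n E v \<ge> 1"
  shows "deg_inv_sqrt_mat n E * lazy_walk n E ^\<^sub>m t = norm_walk n E ^\<^sub>m t * deg_inv_sqrt_mat n E"
proof -
  let ?D = "deg_inv_sqrt_mat n E" and ?M = "lazy_walk n E" and ?N = "norm_walk n E"
  have D: "?D \<in> carrier_mat n n" by (simp add: deg_inv_sqrt_mat_def)
  have M: "?M \<in> carrier_mat n n"
    unfolding lazy_walk_def
    by (intro smult_carrier_mat add_carrier_mat mult_carrier_mat[of _ n n])
      (simp_all add: adj_mat_def deg_inv_mat_def)
  have row_delta: "(\<Sum>i<n. (if u = i then a else 0) * g i) = a * g u" if "u < n" for a :: real and g u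
    using that by (subst sum.cong[OF refl, of _ _ "\<lambda>i. if i = u then a * g i else 0"]) auto
  have col_delta: "(\<Sum>i<n. g i * (if i = u then a else 0)) = g u * a" if "u < n" for a :: real and g u
    using that by (subst sum.cong[OF refl, of _ _ "\<lambda>i. if i = u then g i * a else 0"]) auto
  have Me: "?M $$ (u, v) = (of_bool (u = v) + of_bool (E u v) / deg n E v) / 2" if "u < n" "v < n" for u v
  proof -
    have "(adj_mat n E * deg_inv_mat n E) $$ (u, v)
        = (\<Sum>i<n. (if E u i then 1 else 0) * (if i = v then 1 / deg n E v else 0))"
      using that by (auto simp: adj_mat_def deg_inv_mat_def scalar_prod_def lessThan_atLeast0 intro!: sum.cong)
    also have "\<dots> = of_bool (E u v) / deg n E v"
      using that by (subst col_delta) auto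
    finally show ?thesis
      using that by (auto simp: lazy_walk_def adj_mat_def deg_inv_mat_def)
  qed
  have DM: "?D * ?M = ?N * ?D"
  proof (rule eq_matI)
    fix u v assume "u < dim_row (?N * ?D)" "v < dim_col (?N * ?D)"
    then have uv: "u < n" "v < n" by (auto simp: norm_walk_def deg_inv_sqrt_mat_def)
    have pos: "sqrt (deg n E u) > 0" "sqrt (deg n E v) > 0" using deg1 uv by force+
    have sq: "real (deg n E v) = sqrt (deg n E v) * sqrt (deg n E v)" by simp
    have "(?D * ?M) $$ (u, v) = (\<Sum>i<n. (if u = i then 1 / sqrt (deg n E u) else 0) * ?M $$ (i, v))"
      using uv M D by (auto simp: scalar_prod_def lessThan_atLeast0 deg_inv_sqrt_mat_def intro!: sum.cong)
    also have "\<dots> = 1 / sqrt (deg n E u) * ((of_bool (u = v) + of_bool (E u v) / deg n E v) / 2)"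
      using uv by (subst row_delta) (auto simp: Me)
    also have "\<dots> = ?N $$ (u, v) * (1 / sqrt (deg n E v))"
    proof -
      \<comment> \<open>The identity part contributes \<open>d / p\<close> on one side and
        \<open>d / q\<close> on the other. These agree because \<open>d\<close> is nonzero only on
        the diagonal, where \<open>p\<close> and \<open>q\<close> are square roots of the same
        degree.\<close>
      have gen: "1 / p * ((d + e / (q * q)) / 2) = (d + e / (p * q)) / 2 * (1 / q)"
        if "p > 0" "q > 0" "d = 0 \<or> p = q" for p q d e :: real
        using that by (auto simp: field_simps)
      show ?thesis
        using uv gen[OF pos, of "of_bool (u = v)" "of_bool (E u v)"]
        by (subst sq) (auto simp: norm_walk_def simp del: real_sqrt_mult_self)
    qed
    also have "\<dots> = (\<Sum>i<n. ?N $$ (u, i) * (if i = v then 1 / sqrt (deg n E v) else 0))"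
      using uv by (subst col_delta) auto
    also have "\<dots> = (?N * ?D) $$ (u, v)"
      using uv by (auto simp: scalar_prod_def lessThan_atLeast0 deg_inv_sqrt_mat_def norm_walk_def intro!: sum.cong)
    finally show "(?D * ?M) $$ (u, v) = (?N * ?D) $$ (u, v)" .
  qed (use M D in \<open>auto simp: norm_walk_def\<close>)
  show ?thesis
  proof (induction t)
    case 0
    then show ?case using M D by (simp add: norm_walk_def lazy_walk_def deg_inv_sqrt_mat_def adj_mat_def deg_inv_mat_def)
  next
    case (Suc t)
    have Mt: "?M ^\<^sub>m t \<in> carrier_mat n n" and Nt: "?N ^\<^sub>m t \<in> carrier_mat n n"
      using M by (auto intro: pow_carrier_mat)
    have "?D * ?M ^\<^sub>m Suc t = (?D * ?M ^\<^sub>m t) * ?M"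
      using D M Mt by (simp add: assoc_mult_mat[of _ n n _ n _ n])
    also have "\<dots> = ?N ^\<^sub>m t * (?D * ?M)"
      unfolding Suc using D M Nt by (subst assoc_mult_mat[of _ n n _ n _ n]) auto
    also have "\<dots> = ?N ^\<^sub>m Suc t * ?D"
      unfolding DM using D Nt by (subst assoc_mult_mat[of _ n n _ n _ n, symmetric]) auto
    finally show ?case .
  qed
qed

section \<open>Projection onto the eigenvectors with large eigenvalue\<close>

lemma sum_of_bool_deg_eq_vol:
  assumes "C \<subseteq> {..<n}"
  shows "(\<Sum>v<n. of_bool (v \<in> C) * real (deg n E v)) = real (vol n E C)"
proof -
  have "(\<Sum>v<n. of_bool (v \<in> C) * real (deg n E v)) = (\<Sum>v\<in>{..<n} \<inter> C. real (deg n E v))"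
    by (subst sum.inter_restrict) (auto intro!: sum.cong)
  then show ?thesis using assms by (simp add: vol_def Int_absorb1)
qed

text \<open>Symmetry moves \<open>N\<close> onto the eigenvector, so powers act on coordinates in
  the eigenbasis without a diagonalisation of the power itself.\<close>

lemma eigenvector_pow_scalar_prod:
  fixes N :: "real mat"
  assumes N: "N \<in> carrier_mat n n" and sym: "transpose_mat N = N"
    and u: "u \<in> carrier_vec n" and Nu: "N *\<^sub>v u = l \<cdot>\<^sub>v u" and y: "y \<in> carrier_vec n"
  shows "u \<bullet> (N ^\<^sub>m t *\<^sub>v y) = l ^ t * (u \<bullet> y)"
  using y
proof (induction t arbitrary: y)
  case 0
  then show ?case using N by simp
next
  case (Suc t)
  have Ny: "N *\<^sub>v y \<in> carrier_vec n" using N Suc.prems by simp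
  have "u \<bullet> (N ^\<^sub>m Suc t *\<^sub>v y) = u \<bullet> (N ^\<^sub>m t *\<^sub>v (N *\<^sub>v y))"
    using N Suc.prems pow_carrier_mat[OF N, of t] by (simp add: assoc_mult_mat_vec[of _ n n _ n])
  also have "\<dots> = l ^ t * (u \<bullet> (N *\<^sub>v y))" by (rule Suc.IH[OF Ny])
  also have "u \<bullet> (N *\<^sub>v y) = l * (u \<bullet> y)"
    using transpose_vec_mult_scalar[OF N Suc.prems u] sym Nu u Suc.prems by simp
  finally show ?case by simp
qed

text \<open>All spectral information needed for sampling, stated without eigenvectors. The function
  \<open>q l\<close> is the projection Q applied to the indicator of \<open>C l\<close> scaled by
  square roots of degrees. It is chosen before \<open>\<alpha>\<close>, \<open>t\<close> and the
  samples \<open>a\<close>, which is essential for the variance bound later. The three conclusions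
  are: projecting loses little of a step function, projecting does not increase norms, and the
  Cauchy-Schwarz bound for the walked samples.\<close>

lemma spectral_test_functions:
  fixes \<phi> :: real and C :: "nat \<Rightarrow> nat set"
  assumes G: "simple_graph n E" and deg1: "\<forall>v<n. deg n E v \<ge> 1"
    and \<phi>: "0 < \<phi>" "\<phi> \<le> 1/30"
    and sub: "\<forall>i<h. C i \<subseteq> {..<n}" and disj: "\<forall>i<h. \<forall>j<h. i \<noteq> j \<longrightarrow> C i \<inter> C j = {}"
    and cut: "\<forall>i<h. real (cut_edges n E (C i)) \<le> \<phi> * real (vol n E (C i))"
  shows "\<exists>q :: nat \<Rightarrow> nat \<Rightarrow> real.
    (\<forall>\<alpha>. (\<Sum>v<n. ((\<Sum>i<h. \<alpha> i * of_bool (v \<in> C i)) * sqrt (deg n E v) - (\<Sum>l<h. \<alpha> l * q l v))\<^sup>2)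
        \<le> (\<Sum>i<h. (\<alpha> i)\<^sup>2 * real (vol n E (C i))) / 30) \<and>
    (\<forall>l<h. (\<Sum>v<n. (q l v)\<^sup>2) \<le> real (vol n E (C l))) \<and>
    (\<forall>\<alpha> t s a x. (\<forall>j<s. a j < n) \<longrightarrow> x \<in> carrier_vec s \<longrightarrow>
       (let y = deg_inv_sqrt_mat n E * lazy_walk n E ^\<^sub>m t * sample_mat n s a *\<^sub>v x
        in (1 - 30 * \<phi>) ^ (2 * t) * (\<Sum>j<s. x $ j * (\<Sum>l<h. \<alpha> l * q l (a j)) / sqrt (deg n E (a j)))\<^sup>2
             \<le> (y \<bullet> y) * (\<Sum>i<h. (\<alpha> i)\<^sup>2 * real (vol n E (C i)))))"
proof -
  let ?N = "norm_walk n E" and ?D = "deg_inv_sqrt_mat n E"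
  have N: "?N \<in> carrier_mat n n" by simp
  have D: "?D \<in> carrier_mat n n" by (simp add: deg_inv_sqrt_mat_def)
  have pos: "sqrt (deg n E v) > 0" if "v < n" for v using deg1 that by force
  obtain u lam where u: "\<And>i. i < n \<Longrightarrow> u i \<in> carrier_vec n"
    and Nu: "\<And>i. i < n \<Longrightarrow> ?N *\<^sub>v u i = lam i \<cdot>\<^sub>v u i"
    and uu: "\<And>i j. i < n \<Longrightarrow> j < n \<Longrightarrow> u i \<bullet> u j = (if i = j then 1 else 0)"
    using real_symmetric_spectral[OF N norm_walk_symmetric[OF G]] by blast
  have parseval: "x \<bullet> y = (\<Sum>i<n. (u i \<bullet> x) * (u i \<bullet> y))"
    if "x \<in> carrier_vec n" "y \<in> carrier_vec n" for x y
    using that by (intro orthonormal_parseval u uu)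
  \<comment> \<open>Any vector is a degree-scaled function, so the Dirichlet form of an eigenvector
    is nonnegative. The bound keeps the good coordinates from contributing negative energy
    below.\<close>
  have lam1: "lam i \<le> 1" if i: "i < n" for i
  proof -
    define f where "f v = u i $ v / sqrt (deg n E v)" for v
    have ui: "u i = vec n (\<lambda>v. f v * sqrt (deg n E v))"
      using u[OF i] by (intro eq_vecI) (auto simp: f_def dest!: pos)
    have "u i \<bullet> u i - u i \<bullet> (?N *\<^sub>v u i) \<ge> 0"
      unfolding ui norm_walk_dirichlet_form[OF G deg1] by (intro divide_nonneg_nonneg sum_nonneg) auto
    then show ?thesis using Nu[OF i] uu[OF i i] u[OF i] by simp
  qed
  \<comment> \<open>The cutoff makes each coordinate outside \<open>Good\<close> cost energy more
    than \<open>30 * \<phi>\<close> times its square. Total energy at most \<open>\<phi>\<close>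
    times the squared norm then leaves at most 1/30 of that norm outside.\<close>
  define Good where "Good = {i. i < n \<and> lam i \<ge> 1 - 30 * \<phi>}"
  have Good: "Good \<subseteq> {..<n}" by (auto simp: Good_def)
  define Q where "Q x = vec n (\<lambda>v. \<Sum>i\<in>Good. (u i \<bullet> x) * u i $ v)" for x
  have Qc: "Q x \<in> carrier_vec n" for x by (simp add: Q_def)
  have sprod: "x \<bullet> y = (\<Sum>v<n. x $ v * y $ v)" if "y \<in> carrier_vec n" for x y :: "real vec"
    using that by (simp add: scalar_prod_def lessThan_atLeast0)
  have scQ: "y \<bullet> Q x = (\<Sum>i\<in>Good. (u i \<bullet> x) * (y \<bullet> u i))" for x y
  proof -
    have "y \<bullet> Q x = (\<Sum>v<n. \<Sum>i\<in>Good. y $ v * ((u i \<bullet> x) * u i $ v))"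
      unfolding sprod[OF Qc] by (intro sum.cong refl) (simp add: Q_def sum_distrib_left)
    also have "\<dots> = (\<Sum>i\<in>Good. \<Sum>v<n. y $ v * ((u i \<bullet> x) * u i $ v))" by (rule sum.swap)
    also have "\<dots> = (\<Sum>i\<in>Good. (u i \<bullet> x) * (y \<bullet> u i))"
      using Good by (intro sum.cong refl) (auto simp: sprod[OF u] sum_distrib_left mult_ac)
    finally show ?thesis .
  qed
  have uQ: "u i \<bullet> Q x = (if i \<in> Good then u i \<bullet> x else 0)" if i: "i < n" for i x
  proof -
    have "u i \<bullet> Q x = (\<Sum>j\<in>Good. if j = i then u i \<bullet> x else 0)"
      unfolding scQ using Good i by (intro sum.cong refl) (auto simp: uu)
    then show ?thesis using Good finite_subset[OF Good] by simp
  qed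
  define hv where "hv l = vec n (\<lambda>v. of_bool (v \<in> C l) * sqrt (deg n E v))" for l
  define q where "q l v = Q (hv l) $ v" for l v
  define f where "f \<alpha> v = (\<Sum>i<h. \<alpha> i * of_bool (v \<in> C i))" for \<alpha> :: "nat \<Rightarrow> real" and v
  define z where "z \<alpha> = vec n (\<lambda>v. f \<alpha> v * sqrt (deg n E v))" for \<alpha>
  define V where "V \<alpha> = (\<Sum>i<h. (\<alpha> i)\<^sup>2 * real (vol n E (C i)))" for \<alpha>
  have hc: "hv l \<in> carrier_vec n" for l by (simp add: hv_def)
  have zc: "z \<alpha> \<in> carrier_vec n" for \<alpha> by (simp add: z_def)
  have zv: "z \<alpha> $ v = f \<alpha> v * sqrt (deg n E v)" if "v < n" for \<alpha> v
    using that by (simp add: z_def)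
  have uz: "y \<bullet> z \<alpha> = (\<Sum>l<h. \<alpha> l * (y \<bullet> hv l))" for y \<alpha>
    unfolding sprod[OF zc] sprod[OF hc]
    by (simp add: z_def hv_def f_def sum_distrib_left sum_distrib_right mult_ac) (rule sum.swap)
  have Qz: "Q (z \<alpha>) $ v = (\<Sum>l<h. \<alpha> l * q l v)" if "v < n" for v \<alpha>
    using that
    by (simp add: Q_def q_def uz sum_distrib_left sum_distrib_right mult_ac) (rule sum.swap)
  have zz: "z \<alpha> \<bullet> z \<alpha> = V \<alpha>" for \<alpha>
  proof -
    have "z \<alpha> \<bullet> z \<alpha> = (\<Sum>v<n. (f \<alpha> v)\<^sup>2 * real (deg n E v))"
      unfolding sprod[OF zc] by (intro sum.cong refl) (simp add: z_def power2_eq_square flip: real_sqrt_mult)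
    also have "\<dots> = (\<Sum>v<n. \<Sum>i<h. (\<alpha> i)\<^sup>2 * (of_bool (v \<in> C i) * real (deg n E v)))"
      unfolding f_def step_function_square[OF disj] by (simp only: sum_distrib_right mult.assoc)
    also have "\<dots> = V \<alpha>"
      using sub by (subst sum.swap)
        (auto simp: V_def sum_of_bool_deg_eq_vol simp flip: sum_distrib_left intro!: sum.cong)
    finally show ?thesis .
  qed
  have "(\<Sum>v<n. (f \<alpha> v * sqrt (deg n E v) - (\<Sum>l<h. \<alpha> l * q l v))\<^sup>2) \<le> V \<alpha> / 30" for \<alpha>
  proof -
    let ?w = "z \<alpha> - Q (z \<alpha>)"
    have w: "?w \<in> carrier_vec n" using zc Qc by simp
    have uw: "u i \<bullet> ?w = (if i \<in> Good then 0 else u i \<bullet> z \<alpha>)" if "i < n" for i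
      using scalar_prod_minus_distrib[OF u[OF that] zc Qc] uQ[OF that] by simp
    have "z \<alpha> \<bullet> z \<alpha> - z \<alpha> \<bullet> (?N *\<^sub>v z \<alpha>) \<le> \<phi> * V \<alpha>"
    proof -
      have "z \<alpha> \<bullet> z \<alpha> - z \<alpha> \<bullet> (?N *\<^sub>v z \<alpha>) \<le> (\<Sum>i<h. (\<alpha> i)\<^sup>2 * real (cut_edges n E (C i)))"
        using dirichlet_form_step_function_le[OF G sub disj, of \<alpha>]
        unfolding z_def norm_walk_dirichlet_form[OF G deg1] f_def by simp
      also have "\<dots> \<le> (\<Sum>i<h. (\<alpha> i)\<^sup>2 * (\<phi> * real (vol n E (C i))))"
        using cut by (intro sum_mono mult_left_mono) auto
      finally show ?thesis by (simp add: V_def sum_distrib_left mult_ac)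
    qed
    moreover have "z \<alpha> \<bullet> (?N *\<^sub>v z \<alpha>) = (\<Sum>i<n. lam i * (u i \<bullet> z \<alpha>)\<^sup>2)"
    proof -
      have "u i \<bullet> (?N *\<^sub>v z \<alpha>) = lam i * (u i \<bullet> z \<alpha>)" if "i < n" for i
        using eigenvector_pow_scalar_prod[OF N norm_walk_symmetric[OF G] u[OF that] Nu[OF that] zc, of 1 \<alpha>] N
        by simp
      then show ?thesis
        by (subst parseval[OF zc mult_mat_vec_carrier[OF N zc]])
          (auto simp: power2_eq_square intro!: sum.cong)
    qed
    ultimately have "(\<Sum>i<n. (1 - lam i) * (u i \<bullet> z \<alpha>)\<^sup>2) \<le> \<phi> * V \<alpha>"
      using parseval[OF zc zc, of \<alpha> \<alpha>] by (simp add: left_diff_distrib sum_subtractf power2_eq_square)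
    \<comment> \<open>\<open>?w\<close> consists of the coordinates of \<open>z \<alpha>\<close>
      outside \<open>Good\<close>; dropping the good ones only decreases the energy.\<close>
    moreover have "30 * \<phi> * (?w \<bullet> ?w) \<le> (\<Sum>i<n. (1 - lam i) * (u i \<bullet> z \<alpha>)\<^sup>2)"
      unfolding parseval[OF w w] sum_distrib_left
    proof (rule sum_mono)
      fix i assume "i \<in> {..<n}"
      then have i: "i < n" by simp
      show "30 * \<phi> * (u i \<bullet> ?w * (u i \<bullet> ?w)) \<le> (1 - lam i) * (u i \<bullet> z \<alpha>)\<^sup>2"
      proof (cases "i \<in> Good")
        case True
        then show ?thesis using lam1[OF i] by (simp add: uw[OF i])
      next
        case False
        then have "30 * \<phi> \<le> 1 - lam i" using i by (simp add: Good_def)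
        then show ?thesis using False by (simp add: uw[OF i] power2_eq_square mult_right_mono)
      qed
    qed
    ultimately have "30 * \<phi> * (?w \<bullet> ?w) \<le> \<phi> * V \<alpha>" by linarith
    then have "?w \<bullet> ?w \<le> V \<alpha> / 30" using \<phi> by (simp add: field_simps)
    moreover have "?w \<bullet> ?w = (\<Sum>v<n. (f \<alpha> v * sqrt (deg n E v) - (\<Sum>l<h. \<alpha> l * q l v))\<^sup>2)"
      unfolding sprod[OF w] using carrier_vecD[OF Qc[of "z \<alpha>"]] carrier_vecD[OF zc[of \<alpha>]]
      by (intro sum.cong refl) (simp add: Qz zv power2_eq_square)
    ultimately show ?thesis by simp
  qed
  moreover have "(\<Sum>v<n. (q l v)\<^sup>2) \<le> real (vol n E (C l))" if l: "l < h" for l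
  proof -
    have "(\<Sum>v<n. (q l v)\<^sup>2) = Q (hv l) \<bullet> Q (hv l)"
      by (simp add: sprod[OF Qc] q_def power2_eq_square)
    also have "\<dots> \<le> hv l \<bullet> hv l"
      unfolding parseval[OF Qc Qc] parseval[OF hc hc] by (intro sum_mono) (simp add: uQ)
    also have "\<dots> = (\<Sum>v<n. of_bool (v \<in> C l) * real (deg n E v))"
      unfolding sprod[OF hc] by (intro sum.cong refl) (auto simp: hv_def)
    also have "\<dots> = real (vol n E (C l))" using sub l by (intro sum_of_bool_deg_eq_vol) auto
    finally show ?thesis .
  qed
  moreover have "(1 - 30 * \<phi>) ^ (2 * t) * (\<Sum>j<s. x $ j * (\<Sum>l<h. \<alpha> l * q l (a j)) / sqrt (deg n E (a j)))\<^sup>2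
             \<le> (y \<bullet> y) * V \<alpha>"
    if a: "\<forall>j<s. a j < n" and x: "x \<in> carrier_vec s"
      and y: "y = ?D * lazy_walk n E ^\<^sub>m t * sample_mat n s a *\<^sub>v x" for \<alpha> t s a x y
  proof -
    have S: "sample_mat n s a \<in> carrier_mat n s" by (simp add: sample_mat_def)
    \<comment> \<open>\<open>\<tau>\<close> is the weighted sample vector before walking. Its
      pairing with the projected step function visits each sample once, which gives the sum over
      \<open>j\<close> in the claim.\<close>
    define \<tau> where "\<tau> = ?D *\<^sub>v (sample_mat n s a *\<^sub>v x)"
    have \<tau>: "\<tau> \<in> carrier_vec n" using S D x by (simp add: \<tau>_def)
    have Nt: "?N ^\<^sub>m t \<in> carrier_mat n n" by (rule pow_carrier_mat[OF N])
    have y': "y = ?N ^\<^sub>m t *\<^sub>v \<tau>"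
      unfolding y deg_inv_sqrt_lazy_walk[OF G deg1] \<tau>_def
      by (simp add: assoc_mult_mat_vec[OF mult_carrier_mat[OF Nt D] S x]
          assoc_mult_mat_vec[OF Nt D mult_mat_vec_carrier[OF S x]])
    have yc: "y \<in> carrier_vec n" unfolding y' by (rule mult_mat_vec_carrier[OF Nt \<tau>])
    have \<tau>v: "\<tau> $ v = (\<Sum>j<s. of_bool (a j = v) * x $ j) / sqrt (deg n E v)" if v: "v < n" for v
    proof -
      have Sx: "(sample_mat n s a *\<^sub>v x) $ w = (\<Sum>j<s. of_bool (a j = w) * x $ j)" if "w < n" for w
        using that x by (auto simp: sample_mat_def scalar_prod_def lessThan_atLeast0 intro!: sum.cong)
      have "\<tau> $ v = (\<Sum>w<n. (if v = w then 1 / sqrt (deg n E v) else 0) * (sample_mat n s a *\<^sub>v x) $ w)"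
        unfolding \<tau>_def using v x D S
        by (subst index_mult_mat_vec) (auto simp: deg_inv_sqrt_mat_def sprod[of "sample_mat n s a *\<^sub>v x"] intro!: sum.cong)
      also have "\<dots> = (\<Sum>w<n. if w = v then (sample_mat n s a *\<^sub>v x) $ v / sqrt (deg n E v) else 0)"
        by (intro sum.cong refl) auto
      finally show ?thesis using v by (simp add: Sx)
    qed
    have "\<tau> \<bullet> Q (z \<alpha>) = (\<Sum>v<n. \<Sum>j<s. of_bool (a j = v) * (x $ j * Q (z \<alpha>) $ v / sqrt (deg n E v)))"
      unfolding sprod[OF Qc]
      by (intro sum.cong refl) (simp add: \<tau>v sum_distrib_left sum_distrib_right sum_divide_distrib mult_ac)
    also have "\<dots> = (\<Sum>j<s. \<Sum>v<n. if v = a j then x $ j * Q (z \<alpha>) $ v / sqrt (deg n E v) else 0)"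
      by (subst sum.swap) (auto intro!: sum.cong)
    also have "\<dots> = (\<Sum>j<s. x $ j * (\<Sum>l<h. \<alpha> l * q l (a j)) / sqrt (deg n E (a j)))"
      using a by (intro sum.cong refl) (auto simp: Qz)
    finally have "(\<Sum>j<s. x $ j * (\<Sum>l<h. \<alpha> l * q l (a j)) / sqrt (deg n E (a j)))
        = (\<Sum>i\<in>Good. (u i \<bullet> z \<alpha>) * (\<tau> \<bullet> u i))" by (simp add: scQ)
    then have "(\<Sum>j<s. x $ j * (\<Sum>l<h. \<alpha> l * q l (a j)) / sqrt (deg n E (a j)))\<^sup>2
        \<le> (\<Sum>i\<in>Good. (u i \<bullet> z \<alpha>)\<^sup>2) * (\<Sum>i\<in>Good. (\<tau> \<bullet> u i)\<^sup>2)"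
      using Cauchy_Schwarz_ineq_sum[of "\<lambda>i. u i \<bullet> z \<alpha>" "\<lambda>i. \<tau> \<bullet> u i" Good] by (simp only:)
    also have "\<dots> \<le> V \<alpha> * (\<Sum>i\<in>Good. (\<tau> \<bullet> u i)\<^sup>2)"
    proof (intro mult_right_mono sum_nonneg)
      have "(\<Sum>i\<in>Good. (u i \<bullet> z \<alpha>)\<^sup>2) \<le> (\<Sum>i<n. (u i \<bullet> z \<alpha>)\<^sup>2)"
        using Good by (intro sum_mono2) auto
      then show "(\<Sum>i\<in>Good. (u i \<bullet> z \<alpha>)\<^sup>2) \<le> V \<alpha>"
        using parseval[OF zc zc, of \<alpha> \<alpha>] by (simp add: zz power2_eq_square)
    qed auto
    finally have "(1 - 30 * \<phi>) ^ (2 * t) * (\<Sum>j<s. x $ j * (\<Sum>l<h. \<alpha> l * q l (a j)) / sqrt (deg n E (a j)))\<^sup>2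
        \<le> (1 - 30 * \<phi>) ^ (2 * t) * (V \<alpha> * (\<Sum>i\<in>Good. (\<tau> \<bullet> u i)\<^sup>2))"
      using \<phi> by (intro mult_left_mono zero_le_power) auto
    also have "\<dots> = V \<alpha> * (\<Sum>i\<in>Good. (1 - 30 * \<phi>) ^ (2 * t) * (\<tau> \<bullet> u i)\<^sup>2)"
      by (simp add: mult.left_commute flip: sum_distrib_left)
    also have "\<dots> \<le> V \<alpha> * (\<Sum>i\<in>Good. (lam i) ^ (2 * t) * (\<tau> \<bullet> u i)\<^sup>2)"
      using \<phi> by (intro mult_left_mono sum_mono mult_right_mono power_mono)
        (auto simp: Good_def V_def intro!: sum_nonneg)
    \<comment> \<open>Enlarging the sum beyond \<open>Good\<close> is harmless because the exponent
      \<open>2 * t\<close> is even, whatever the signs of the remaining eigenvalues.\<close>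
    also have "\<dots> \<le> V \<alpha> * (\<Sum>i<n. (lam i) ^ (2 * t) * (\<tau> \<bullet> u i)\<^sup>2)"
      using Good by (intro mult_left_mono sum_mono2) (auto simp: V_def power_mult intro!: sum_nonneg)
    also have "(\<Sum>i<n. (lam i) ^ (2 * t) * (\<tau> \<bullet> u i)\<^sup>2) = (\<Sum>i<n. (u i \<bullet> y) * (u i \<bullet> y))"
      using eigenvector_pow_scalar_prod[OF N norm_walk_symmetric[OF G] u Nu \<tau>] comm_scalar_prod[OF \<tau> u]
      by (intro sum.cong refl) (simp add: y' power_mult power2_eq_square power_mult_distrib)
    also have "\<dots> = y \<bullet> y" using parseval[OF yc yc] by simp
    finally show ?thesis by (simp add: mult.commute)
  qed
  ultimately show ?thesis
    unfolding f_def V_def Let_def by (intro exI[of _ q]) blast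
qed

section \<open>Sampling\<close>

text \<open>Independence removes the mixed terms, so the variance of the sum is \<open>s\<close>
  times a single variance, and that is at most the second moment. Finite support takes care of
  integrability.\<close>

lemma expectation_square_sum_Pi_pmf:
  fixes f :: "nat \<Rightarrow> real"
  assumes fin: "finite (set_pmf p)"
  shows "measure_pmf.expectation (Pi_pmf {..<s} d (\<lambda>_. p))
           (\<lambda>a. (\<Sum>j<s. f (a j) - measure_pmf.expectation p f)\<^sup>2)
         \<le> real s * measure_pmf.expectation p (\<lambda>x. (f x)\<^sup>2)"
proof -
  define c where "c = measure_pmf.expectation p f"
  define g where "g x = f x - c" for x
  let ?Q = "Pi_pmf {..<s} d (\<lambda>_. p)"
  have int: "integrable (measure_pmf p) h" for h :: "nat \<Rightarrow> real"
    by (rule integrable_measure_pmf_finite[OF fin])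
  have finQ: "finite (set_pmf ?Q)"
    by (rule finite_subset[OF set_Pi_pmf_subset']) (auto intro!: finite_PiE_dflt fin)
  have intQ: "integrable (measure_pmf ?Q) h" for h :: "(nat \<Rightarrow> nat) \<Rightarrow> real"
    by (rule integrable_measure_pmf_finite[OF finQ])
  have M: "prob_space (measure_pmf ?Q)" by (rule measure_pmf.prob_space_axioms)
  have g0: "measure_pmf.expectation p g = 0"
    unfolding g_def using int by (simp add: c_def)
  have comp: "measure_pmf.expectation ?Q (\<lambda>a. h (a j)) = measure_pmf.expectation p h"
    if "j < s" for h :: "nat \<Rightarrow> real" and j
  proof -
    have "measure_pmf.expectation ?Q (\<lambda>a. h (a j)) = measure_pmf.expectation (map_pmf (\<lambda>a. a j) ?Q) h"
      by simp
    also have "map_pmf (\<lambda>a. a j) ?Q = p"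
      using that by (subst Pi_pmf_component) auto
    finally show ?thesis .
  qed
  have cross: "measure_pmf.expectation ?Q (\<lambda>a. g (a i) * g (a j)) = 0"
    if ij: "i < s" "j < s" "i \<noteq> j" for i j
  proof -
    have "prob_space.indep_vars ?Q (\<lambda>_. borel) (\<lambda>i a. g (a i)) {..<s}"
      by (rule prob_space.indep_vars_compose2[OF M indep_vars_Pi_pmf]) auto
    \<comment> \<open>Pairwise independence is obtained as independence of one variable from a sum
      over the singleton \<open>{j}\<close>.\<close>
    then have "prob_space.indep_var ?Q borel (\<lambda>a. g (a i)) borel (\<lambda>a. g (a j))"
      using ij prob_space.indep_vars_sum[OF M, of "{j}" i "\<lambda>i a. g (a i)"]
        prob_space.indep_vars_subset[OF M, of "\<lambda>_. borel" "\<lambda>i a. g (a i)" "{..<s}" "{i, j}"] by auto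
    then show ?thesis
      using ij comp[of i g] g0 by (subst prob_space.indep_var_lebesgue_integral[OF M]) (auto intro: intQ)
  qed
  have "measure_pmf.expectation ?Q (\<lambda>a. (\<Sum>j<s. g (a j))\<^sup>2)
      = (\<Sum>i<s. \<Sum>j<s. measure_pmf.expectation ?Q (\<lambda>a. g (a i) * g (a j)))"
    by (simp add: power2_eq_square sum_product intQ)
  also have "\<dots> = (\<Sum>i<s. \<Sum>j<s. if j = i then measure_pmf.expectation p (\<lambda>x. g x * g x) else 0)"
    using comp[of _ "\<lambda>x. g x * g x"] by (intro sum.cong refl) (auto simp: cross)
  also have "\<dots> = real s * measure_pmf.expectation p (\<lambda>x. g x * g x)"
    by simp
  also have "measure_pmf.expectation p (\<lambda>x. g x * g x) =
      measure_pmf.expectation p (\<lambda>x. (f x)\<^sup>2 - 2 * c * f x + c\<^sup>2)"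
    by (simp add: g_def power2_eq_square algebra_simps)
  also have "\<dots> = measure_pmf.expectation p (\<lambda>x. (f x)\<^sup>2) - c\<^sup>2"
    using int by (simp add: c_def power2_eq_square)
  finally show ?thesis
    by (simp add: g_def c_def mult_left_mono)
qed

text \<open>Markov's inequality for the sum of squared deviations controls all indices in
  \<open>I\<close> in one event. The functions for different indices share the same samples, and no
  independence between them is required.\<close>

lemma prob_deviation_ge_le:
  fixes \<kappa> :: "'i \<Rightarrow> nat \<Rightarrow> real"
  assumes fin: "finite (set_pmf p)" and B: "B > 0"
  shows "measure_pmf.prob (Pi_pmf {..<s} d (\<lambda>_. p))
      {a. B \<le> (\<Sum>i\<in>I. (\<Sum>j<s. \<kappa> i (a j) - measure_pmf.expectation p (\<kappa> i))\<^sup>2)}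
    \<le> real s * (\<Sum>i\<in>I. measure_pmf.expectation p (\<lambda>x. (\<kappa> i x)\<^sup>2)) / B"
proof -
  let ?Q = "Pi_pmf {..<s} d (\<lambda>_. p)"
  let ?Z = "\<lambda>i a. (\<Sum>j<s. \<kappa> i (a j) - measure_pmf.expectation p (\<kappa> i))\<^sup>2"
  have finQ: "finite (set_pmf ?Q)"
    by (rule finite_subset[OF set_Pi_pmf_subset']) (auto intro!: finite_PiE_dflt fin)
  have intQ: "integrable (measure_pmf ?Q) h" for h :: "(nat \<Rightarrow> nat) \<Rightarrow> real"
    by (rule integrable_measure_pmf_finite[OF finQ])
  have "measure_pmf.prob ?Q {a. B \<le> (\<Sum>i\<in>I. ?Z i a)} \<le> measure_pmf.expectation ?Q (\<lambda>a. \<Sum>i\<in>I. ?Z i a) / B"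
    using integral_Markov_inequality_measure[OF intQ, of UNIV "\<lambda>a. \<Sum>i\<in>I. ?Z i a" B] B
    by (simp add: sum_nonneg)
  also have "measure_pmf.expectation ?Q (\<lambda>a. \<Sum>i\<in>I. ?Z i a) = (\<Sum>i\<in>I. measure_pmf.expectation ?Q (?Z i))"
    by (simp add: intQ)
  also have "\<dots> / B \<le> (\<Sum>i\<in>I. real s * measure_pmf.expectation p (\<lambda>x. (\<kappa> i x)\<^sup>2)) / B"
    using B by (intro divide_right_mono sum_mono expectation_square_sum_Pi_pmf fin) auto
  finally show ?thesis by (simp add: sum_distrib_left)
qed

section \<open>The sampled quadratic form\<close>

lemma sum_pairs: "sum F (A \<times> B) = (\<Sum>i\<in>A. \<Sum>l\<in>B. F (i, l))"
  by (simp add: sum.cartesian_product)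

text \<open>\<open>d\<close> stands for the degrees and \<open>W\<close> for the total volume; the
  adjacency relation does not enter the sampling argument.\<close>

locale near_stationary_sampling =
  fixes n :: nat and d :: "nat \<Rightarrow> real" and W \<eta> :: real and P :: "nat pmf"
  assumes d_pos: "\<And>v. v < n \<Longrightarrow> d v > 0" and W_pos: "W > 0" and eta: "0 < \<eta>" "\<eta> \<le> 1/2"
    and P_sub: "set_pmf P \<subseteq> {..<n}"
    and P_near: "\<And>v. v < n \<Longrightarrow> \<bar>pmf P v - d v / W\<bar> \<le> \<eta> * d v / W"
begin

lemma pmf_bounds:
  assumes "v < n"
  shows "1 / (2 * W) \<le> pmf P v / d v" "pmf P v / d v \<le> 3 / (2 * W)"
proof -
  have "\<bar>pmf P v - d v / W\<bar> \<le> 1/2 * (d v / W)"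
    using P_near[OF assms] mult_right_mono[OF eta(2), of "d v / W"] d_pos[OF assms] W_pos by simp
  then have "1/2 * (d v / W) \<le> pmf P v" "pmf P v \<le> 3/2 * (d v / W)"
    by linarith+
  then show "1 / (2 * W) \<le> pmf P v / d v" "pmf P v / d v \<le> 3 / (2 * W)"
    using d_pos[OF assms] W_pos by (auto simp: field_simps)
qed

lemma expectation_eq: "measure_pmf.expectation P (f :: nat \<Rightarrow> real) = (\<Sum>v<n. pmf P v * f v)"
  using P_sub by (subst integral_measure_pmf_real[of "{..<n}"]) (auto simp: mult.commute)

text \<open>With \<open>z = f * sqrt d\<close> the expectation is a sum of \<open>z * g\<close> with
  weights \<open>pmf P v / d v\<close>. The product may be negative, so the two-sided bounds on the
  weights cannot be applied to it; it is first bounded below by a difference of squares. The outcome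
  is 3/8 - (3/2)/30 = 13/40, rounded down to 3/10.\<close>

lemma expected_form_ge:
  fixes f g :: "nat \<Rightarrow> real"
  assumes V: "(\<Sum>v<n. (f v)\<^sup>2 * d v) = V"
    and near: "(\<Sum>v<n. (f v * sqrt (d v) - g v)\<^sup>2) \<le> V / 30"
  shows "3 / 10 * V / W \<le> (\<Sum>v<n. pmf P v * (f v * g v / sqrt (d v)))"
proof -
  have V0: "V \<ge> 0" unfolding V[symmetric] using d_pos by (intro sum_nonneg) (auto simp: less_imp_le)
  have pt: "3 / (8 * W) * ((f v)\<^sup>2 * d v) - 3 / (2 * W) * (f v * sqrt (d v) - g v)\<^sup>2
      \<le> pmf P v * (f v * g v / sqrt (d v))" if v: "v < n" for v
  proof -
    define z where "z = f v * sqrt (d v)"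
    define r where "r = pmf P v / d v"
    have zz: "z\<^sup>2 = (f v)\<^sup>2 * d v" using d_pos[OF v] by (simp add: z_def power_mult_distrib)
    \<comment> \<open>Equivalent to
      \<open>z * (z - g v) \<le> z\<^sup>2 / 4 + (z - g v)\<^sup>2\<close>. The error term keeps
      coefficient 1 because it is small in total, while 3/4 of the main term survives.\<close>
    have "(z / 2 - (z - g v))\<^sup>2 \<ge> 0" by simp
    then have zg: "3 / 4 * z\<^sup>2 - (z - g v)\<^sup>2 \<le> z * g v"
      by (simp add: power2_eq_square algebra_simps)
    have r: "1 / (2 * W) \<le> r" "r \<le> 3 / (2 * W)" unfolding r_def by (rule pmf_bounds[OF v])+
    have r0: "r \<ge> 0" using d_pos[OF v] by (simp add: r_def)
    have "3 / (8 * W) * z\<^sup>2 - 3 / (2 * W) * (z - g v)\<^sup>2 \<le> r * (3 / 4 * z\<^sup>2) - r * (z - g v)\<^sup>2"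
      using mult_right_mono[OF r(1), of "3 / 4 * z\<^sup>2"] mult_right_mono[OF r(2), of "(z - g v)\<^sup>2"] by simp
    also have "\<dots> \<le> r * (z * g v)"
      using mult_left_mono[OF zg r0] by (simp add: right_diff_distrib)
    also have "\<dots> = pmf P v * (f v * g v / sqrt (d v))"
      using d_pos[OF v] by (simp add: r_def z_def field_simps)
    finally show ?thesis unfolding zz unfolding z_def .
  qed
  have "3 / 10 * V / W \<le> 3 / (8 * W) * V - 3 / (2 * W) * (V / 30)"
    using V0 W_pos by (simp add: field_simps)
  also have "\<dots> \<le> 3 / (8 * W) * V - 3 / (2 * W) * (\<Sum>v<n. (f v * sqrt (d v) - g v)\<^sup>2)"
    using near W_pos by (intro diff_left_mono mult_left_mono) auto
  also have "\<dots> \<le> (\<Sum>v<n. pmf P v * (f v * g v / sqrt (d v)))"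
    unfolding V[symmetric] sum_distrib_left sum_subtractf[symmetric] using pt by (intro sum_mono) auto
  finally show ?thesis .
qed

end

text \<open>Interface between the spectral and the probabilistic half: \<open>w\<close> holds the
  cluster volumes, and \<open>q_near\<close> and \<open>q_norm\<close> are the first two conclusions
  of \<open>spectral_test_functions\<close>.\<close>

locale clustered_sampling = near_stationary_sampling n d W \<eta> P
  for n :: nat and d :: "nat \<Rightarrow> real" and W \<eta> :: real and P :: "nat pmf" +
  fixes C :: "nat \<Rightarrow> nat set" and q :: "nat \<Rightarrow> nat \<Rightarrow> real" and h :: nat and w :: "nat \<Rightarrow> real" and \<beta> :: real
  assumes sub: "\<And>i. i < h \<Longrightarrow> C i \<subseteq> {..<n}"
    and disj: "\<forall>i<h. \<forall>j<h. i \<noteq> j \<longrightarrow> C i \<inter> C j = {}"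
    and w_eq: "\<And>i. i < h \<Longrightarrow> w i = (\<Sum>v<n. of_bool (v \<in> C i) * d v)"
    and w_ge: "\<And>i. i < h \<Longrightarrow> \<beta> * W / h \<le> w i"
    and w_sum: "(\<Sum>i<h. w i) \<le> W"
    and beta: "\<beta> > 0" and h_pos: "h > 0"
    and q_near: "\<And>\<alpha>. (\<Sum>v<n. ((\<Sum>i<h. \<alpha> i * of_bool (v \<in> C i)) * sqrt (d v) - (\<Sum>l<h. \<alpha> l * q l v))\<^sup>2)
        \<le> (\<Sum>i<h. (\<alpha> i)\<^sup>2 * w i) / 30"
    and q_norm: "\<And>l. l < h \<Longrightarrow> (\<Sum>v<n. (q l v)\<^sup>2) \<le> w l"
begin

text \<open>For \<open>p = (i, l)\<close>, the coefficient of \<open>\<alpha> i * \<alpha> l\<close>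
  in the contribution of one sample at \<open>v\<close> to the quadratic form.\<close>

definition kernel :: "nat \<times> nat \<Rightarrow> nat \<Rightarrow> real" where
  "kernel p v = of_bool (v \<in> C (fst p)) * q (snd p) v / sqrt (d v)"

definition deviation :: "nat \<Rightarrow> (nat \<Rightarrow> nat) \<Rightarrow> nat \<times> nat \<Rightarrow> real" where
  "deviation s a p = (\<Sum>j<s. kernel p (a j) - measure_pmf.expectation P (kernel p))"

text \<open>Disjointness collapses the sum over \<open>i\<close> to at most one term per vertex, and
  the norms of the \<open>q l\<close> add up to at most the total volume. Hence the bound does not
  grow with \<open>h\<close>.\<close>

lemma sum_expectation_kernel_square_le:
  "(\<Sum>p\<in>{..<h} \<times> {..<h}. measure_pmf.expectation P (\<lambda>v. (kernel p v)\<^sup>2)) \<le> 3 / 2"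
proof -
  have "(\<Sum>p\<in>{..<h} \<times> {..<h}. measure_pmf.expectation P (\<lambda>v. (kernel p v)\<^sup>2))
      = (\<Sum>i<h. \<Sum>l<h. \<Sum>v<n. pmf P v * (kernel (i, l) v)\<^sup>2)"
    unfolding expectation_eq by (rule sum_pairs)
  also have "\<dots> = (\<Sum>l<h. \<Sum>v<n. \<Sum>i<h. pmf P v * (kernel (i, l) v)\<^sup>2)"
    by (subst sum.swap) (intro sum.cong refl sum.swap)
  also have "\<dots> \<le> (\<Sum>l<h. \<Sum>v<n. 3 / (2 * W) * (q l v)\<^sup>2)"
  proof (intro sum_mono)
    fix l v assume "v \<in> {..<n}"
    then have v: "v < n" by simp
    have "(\<Sum>i<h. pmf P v * (kernel (i, l) v)\<^sup>2) = (\<Sum>i<h. of_bool (v \<in> C i)) * (pmf P v / d v * (q l v)\<^sup>2)"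
      unfolding sum_distrib_right using d_pos[OF v]
      by (intro sum.cong refl) (auto simp: kernel_def power_divide)
    also have "\<dots> \<le> 1 * (pmf P v / d v * (q l v)\<^sup>2)"
      using sum_of_bool_disjoint_le_1[OF disj, of v] d_pos[OF v] by (intro mult_right_mono) auto
    also have "\<dots> \<le> 3 / (2 * W) * (q l v)\<^sup>2"
      unfolding mult_1 using pmf_bounds[OF v] by (intro mult_right_mono) auto
    finally show "(\<Sum>i<h. pmf P v * (kernel (i, l) v)\<^sup>2) \<le> 3 / (2 * W) * (q l v)\<^sup>2" .
  qed
  also have "\<dots> \<le> (\<Sum>l<h. 3 / (2 * W) * w l)"
    unfolding sum_distrib_left[symmetric] using W_pos q_norm by (intro mult_left_mono sum_mono) auto
  also have "\<dots> = 3 / (2 * W) * (\<Sum>l<h. w l)" by (simp add: sum_distrib_left)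
  also have "\<dots> \<le> 3 / (2 * W) * W" using w_sum W_pos by (intro mult_left_mono) auto
  finally show ?thesis using W_pos by simp
qed

text \<open>By Cauchy-Schwarz over pairs, a quadratic form deviates by at most the Frobenius norm of
  its deviation matrix times the squared norm of \<open>\<alpha>\<close>. One hypothesis on the
  sample therefore serves every \<open>\<alpha>\<close>: the mean 3/10 loses at most 1/5.\<close>

lemma sampled_form_ge:
  fixes \<alpha> :: "nat \<Rightarrow> real"
  assumes dev: "(\<Sum>p\<in>{..<h} \<times> {..<h}. (deviation s a p)\<^sup>2) \<le> (s * \<beta> / (5 * h))\<^sup>2"
  defines "f \<equiv> \<lambda>v. \<Sum>i<h. \<alpha> i * of_bool (v \<in> C i)"
    and "g \<equiv> \<lambda>v. \<Sum>l<h. \<alpha> l * q l v" and "V \<equiv> \<Sum>i<h. (\<alpha> i)\<^sup>2 * w i"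
  shows "s * V / (10 * W) \<le> (\<Sum>j<s. f (a j) * g (a j) / sqrt (d (a j)))"
    and "(\<Sum>i<h. (\<alpha> i)\<^sup>2) * (\<beta> * W / h) \<le> V"
proof -
  let ?I = "{..<h} \<times> {..<h}"
  let ?m = "\<lambda>p. measure_pmf.expectation P (kernel p)"
  have form: "f v * g v / sqrt (d v) = (\<Sum>p\<in>?I. \<alpha> (fst p) * \<alpha> (snd p) * kernel p v)" for v
  proof -
    have "f v * g v = (\<Sum>i<h. \<Sum>l<h. (\<alpha> i * of_bool (v \<in> C i)) * (\<alpha> l * q l v))"
      unfolding f_def g_def by (rule sum_product)
    then have "f v * g v / sqrt (d v) = (\<Sum>i<h. \<Sum>l<h. \<alpha> i * \<alpha> l * kernel (i, l) v)"
      by (simp add: sum_divide_distrib kernel_def mult_ac)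
    then show ?thesis by (simp add: sum_pairs)
  qed
  have V: "(\<Sum>v<n. (f v)\<^sup>2 * d v) = V"
  proof -
    have "(\<Sum>v<n. (f v)\<^sup>2 * d v) = (\<Sum>v<n. \<Sum>i<h. (\<alpha> i)\<^sup>2 * (of_bool (v \<in> C i) * d v))"
      unfolding f_def step_function_square[OF disj] by (simp only: sum_distrib_right mult.assoc)
    also have "\<dots> = V"
      by (subst sum.swap) (simp add: V_def w_eq flip: sum_distrib_left)
    finally show ?thesis .
  qed
  show sq: "(\<Sum>i<h. (\<alpha> i)\<^sup>2) * (\<beta> * W / h) \<le> V"
    unfolding V_def sum_distrib_right using w_ge by (intro sum_mono mult_left_mono) auto
  have exp: "(\<Sum>p\<in>?I. \<alpha> (fst p) * \<alpha> (snd p) * ?m p) = (\<Sum>v<n. pmf P v * (f v * g v / sqrt (d v)))"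
    unfolding form expectation_eq sum_distrib_left by (subst sum.swap) (simp add: mult_ac)
  have mean: "3 / 10 * V / W \<le> (\<Sum>p\<in>?I. \<alpha> (fst p) * \<alpha> (snd p) * ?m p)"
    unfolding exp using q_near[of \<alpha>] by (intro expected_form_ge[OF V]) (simp add: f_def g_def V_def)
  have decomp: "(\<Sum>j<s. f (a j) * g (a j) / sqrt (d (a j)))
      = (\<Sum>p\<in>?I. \<alpha> (fst p) * \<alpha> (snd p) * deviation s a p) + s * (\<Sum>p\<in>?I. \<alpha> (fst p) * \<alpha> (snd p) * ?m p)"
  proof -
    have "(\<Sum>j<s. f (a j) * g (a j) / sqrt (d (a j)))
        = (\<Sum>p\<in>?I. \<Sum>j<s. \<alpha> (fst p) * \<alpha> (snd p) * kernel p (a j))"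
      unfolding form by (rule sum.swap)
    also have "\<dots> = (\<Sum>p\<in>?I. \<alpha> (fst p) * \<alpha> (snd p) * deviation s a p + s * (\<alpha> (fst p) * \<alpha> (snd p) * ?m p))"
      by (intro sum.cong refl) (simp add: deviation_def sum_subtractf right_diff_distrib sum_distrib_left mult_ac)
    finally show ?thesis by (simp add: sum.distrib sum_distrib_left)
  qed
  have "(\<Sum>p\<in>?I. \<alpha> (fst p) * \<alpha> (snd p) * deviation s a p)\<^sup>2
      \<le> (\<Sum>p\<in>?I. (\<alpha> (fst p) * \<alpha> (snd p))\<^sup>2) * (\<Sum>p\<in>?I. (deviation s a p)\<^sup>2)"
    using Cauchy_Schwarz_ineq_sum[of "\<lambda>p. \<alpha> (fst p) * \<alpha> (snd p)" "deviation s a" ?I] by (simp only:)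
  also have "\<dots> \<le> (\<Sum>p\<in>?I. (\<alpha> (fst p) * \<alpha> (snd p))\<^sup>2) * (s * \<beta> / (5 * h))\<^sup>2"
    using dev by (intro mult_left_mono sum_nonneg) auto
  also have "(\<Sum>p\<in>?I. (\<alpha> (fst p) * \<alpha> (snd p))\<^sup>2) = (\<Sum>i<h. (\<alpha> i)\<^sup>2)\<^sup>2"
    by (simp add: sum_pairs power2_eq_square[of "sum _ _"] sum_product power_mult_distrib)
  also have "(\<Sum>i<h. (\<alpha> i)\<^sup>2)\<^sup>2 * (s * \<beta> / (5 * h))\<^sup>2 = ((\<Sum>i<h. (\<alpha> i)\<^sup>2) * (s * \<beta> / (5 * h)))\<^sup>2"
    by (simp only: power_mult_distrib)
  finally have "\<bar>\<Sum>p\<in>?I. \<alpha> (fst p) * \<alpha> (snd p) * deviation s a p\<bar>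
      \<le> \<bar>(\<Sum>i<h. (\<alpha> i)\<^sup>2) * (s * \<beta> / (5 * h))\<bar>"
    by (simp only: abs_le_square_iff)
  also have "\<dots> = (\<Sum>i<h. (\<alpha> i)\<^sup>2) * (s * \<beta> / (5 * h))"
    using beta by (simp only: abs_mult abs_of_nonneg[OF sum_nonneg[OF zero_le_power2]]) simp
  \<comment> \<open>Rewritten so that the lower bound on the cluster volumes applies; this explains
    the threshold \<open>s * \<beta> / (5 * h)\<close>.\<close>
  also have "\<dots> = s / (5 * W) * ((\<Sum>i<h. (\<alpha> i)\<^sup>2) * (\<beta> * W / h))"
    using W_pos by (simp add: field_simps)
  also have "\<dots> \<le> s / (5 * W) * V"
    using W_pos by (intro mult_left_mono sq) auto
  finally have "- (s / (5 * W) * V) \<le> (\<Sum>p\<in>?I. \<alpha> (fst p) * \<alpha> (snd p) * deviation s a p)"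
    by linarith
  moreover have "s * (3 / 10 * V / W) \<le> s * (\<Sum>p\<in>?I. \<alpha> (fst p) * \<alpha> (snd p) * ?m p)"
    by (intro mult_left_mono mean) auto
  moreover have "s * V / (10 * W) = s * (3 / 10 * V / W) - s / (5 * W) * V"
    using W_pos by (simp add: field_simps)
  ultimately show "s * V / (10 * W) \<le> (\<Sum>j<s. f (a j) * g (a j) / sqrt (d (a j)))"
    unfolding decomp by linarith
qed

text \<open>The failure probability is at most \<open>(3/2) * s\<close> over the squared threshold,
  that is 37.5 times \<open>h\<^sup>2 / (\<beta>\<^sup>2 * s)\<close>. This is at most 1/3 once
  \<open>s\<close> reaches 112.5 times \<open>h\<^sup>2 / \<beta>\<^sup>2\<close>, hence
  113.\<close>

lemma prob_deviation_small:
  assumes s: "real s \<ge> 113 * (real h)\<^sup>2 / \<beta>\<^sup>2"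
  shows "measure_pmf.prob (Pi_pmf {..<s} 0 (\<lambda>_. P))
      {a. (\<Sum>p\<in>{..<h} \<times> {..<h}. (deviation s a p)\<^sup>2) < (s * \<beta> / (5 * h))\<^sup>2} \<ge> 2 / 3"
proof -
  let ?Q = "Pi_pmf {..<s} 0 (\<lambda>_. P)" and ?I = "{..<h} \<times> {..<h}"
  let ?B = "(s * \<beta> / (5 * h))\<^sup>2"
  have fin: "finite (set_pmf P)" using P_sub finite_subset by blast
  have "113 * (real h)\<^sup>2 / \<beta>\<^sup>2 > 0" using h_pos beta by simp
  then have s0: "real s > 0" using s by linarith
  then have B: "?B > 0" using h_pos beta by simp
  have "measure_pmf.prob ?Q {a. ?B \<le> (\<Sum>p\<in>?I. (deviation s a p)\<^sup>2)}
      \<le> real s * (\<Sum>p\<in>?I. measure_pmf.expectation P (\<lambda>x. (kernel p x)\<^sup>2)) / ?B"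
    unfolding deviation_def by (rule prob_deviation_ge_le[OF fin B])
  also have "\<dots> \<le> real s * (3 / 2) / ?B"
    using B by (intro divide_right_mono mult_left_mono sum_expectation_kernel_square_le) auto
  also have "\<dots> = 75 / 2 * ((real h)\<^sup>2 / \<beta>\<^sup>2) / s"
    using s0 beta h_pos by (simp add: field_simps power2_eq_square)
  also have "\<dots> \<le> 1 / 3"
  proof -
    have "113 * ((real h)\<^sup>2 / \<beta>\<^sup>2) \<le> s" using s by simp
    then have "75 / 2 * ((real h)\<^sup>2 / \<beta>\<^sup>2) \<le> 1 / 3 * s" using s0 by linarith
    then show ?thesis using s0 by (simp only: pos_divide_le_eq)
  qed
  finally have "measure_pmf.prob ?Q {a. ?B \<le> (\<Sum>p\<in>?I. (deviation s a p)\<^sup>2)} \<le> 1 / 3" .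
  moreover have "{a. (\<Sum>p\<in>?I. (deviation s a p)\<^sup>2) < ?B} = UNIV - {a. ?B \<le> (\<Sum>p\<in>?I. (deviation s a p)\<^sup>2)}"
    by auto
  ultimately show ?thesis
    using measure_pmf.prob_compl[of "{a. ?B \<le> (\<Sum>p\<in>?I. (deviation s a p)\<^sup>2)}" ?Q] by simp
qed

end

section \<open>From the quadratic form to the eigenvalue\<close>

lemma sum_disjoint_vol_le:
  fixes h :: nat
  assumes sub: "\<forall>i<h. C i \<subseteq> {..<n}" and disj: "\<forall>i<h. \<forall>j<h. i \<noteq> j \<longrightarrow> C i \<inter> C j = {}"
  shows "(\<Sum>i<h. real (vol n E (C i))) \<le> real (vol n E {..<n})"
proof -
  have "(\<Sum>i<h. real (vol n E (C i))) = (\<Sum>i<h. \<Sum>v<n. of_bool (v \<in> C i) * real (deg n E v))"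
    using sub by (intro sum.cong refl) (simp add: sum_of_bool_deg_eq_vol)
  also have "\<dots> = (\<Sum>v<n. (\<Sum>i<h. of_bool (v \<in> C i)) * real (deg n E v))"
    unfolding sum_distrib_right by (rule sum.swap)
  also have "\<dots> \<le> (\<Sum>v<n. 1 * real (deg n E v))"
    by (intro sum_mono mult_right_mono sum_of_bool_disjoint_le_1[OF disj]) auto
  finally show ?thesis by (simp add: vol_def)
qed

text \<open>For \<open>x = M *\<^sub>v \<alpha>\<close>, the test inequality and
  \<open>sampled_form_ge\<close> bound the numerator of the Rayleigh quotient below by
  \<open>\<rho> * s\<^sup>2 * V / (100 * W\<^sup>2)\<close>. The denominator is at most
  \<open>s\<close> times the squared norm of \<open>\<alpha>\<close>, hence at most
  \<open>s * h * V / (\<beta> * W)\<close>. The quotient of these bounds is the claim.\<close>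

lemma (in clustered_sampling) mu_sampled_gram_ge:
  fixes X :: "real mat" and \<rho> :: real
  assumes X: "X \<in> carrier_mat n s" and s_pos: "s > 0" and \<rho>: "\<rho> \<ge> 0"
    and dev: "(\<Sum>p\<in>{..<h} \<times> {..<h}. (deviation s a p)\<^sup>2) \<le> (s * \<beta> / (5 * h))\<^sup>2"
    and test: "\<And>\<alpha> x. x \<in> carrier_vec s \<Longrightarrow>
      \<rho> * (\<Sum>j<s. x $ j * (\<Sum>l<h. \<alpha> l * q l (a j)) / sqrt (d (a j)))\<^sup>2
        \<le> ((X *\<^sub>v x) \<bullet> (X *\<^sub>v x)) * (\<Sum>i<h. (\<alpha> i)\<^sup>2 * w i)"
  shows "s * \<beta> / (100 * h * W) * \<rho> \<le> mu h (transpose_mat X * X)"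
proof -
  define M where "M = mat s h (\<lambda>(j, i). of_bool (a j \<in> C i) :: real)"
  have M: "M \<in> carrier_mat s h" by (simp add: M_def)
  have Xt: "transpose_mat X \<in> carrier_mat s n" using X by simp
  have B: "transpose_mat X * X \<in> carrier_mat s s" using X by simp
  have sym: "transpose_mat (transpose_mat X * X) = transpose_mat X * X"
    by (simp add: transpose_mult[OF Xt X])
  have quad: "x \<bullet> (transpose_mat X * X *\<^sub>v x) = (X *\<^sub>v x) \<bullet> (X *\<^sub>v x)" if "x \<in> carrier_vec s" for x
    using transpose_vec_mult_scalar[OF X that mult_mat_vec_carrier[OF X that]] X that
    by (simp add: assoc_mult_mat_vec[OF Xt X that] comm_scalar_prod[of x s])
  define f where "f \<alpha> v = (\<Sum>i<h. \<alpha> i * of_bool (v \<in> C i))" for \<alpha> :: "nat \<Rightarrow> real" and v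
  define V where "V \<alpha> = (\<Sum>i<h. (\<alpha> i)\<^sup>2 * w i)" for \<alpha> :: "nat \<Rightarrow> real"
  define T where "T \<alpha> = (\<Sum>j<s. f \<alpha> (a j) * (\<Sum>l<h. \<alpha> l * q l (a j)) / sqrt (d (a j)))" for \<alpha>
  have T: "s * V \<alpha> / (10 * W) \<le> T \<alpha>" and sq: "(\<Sum>i<h. (\<alpha> i)\<^sup>2) * (\<beta> * W / h) \<le> V \<alpha>" for \<alpha>
    unfolding T_def V_def f_def by (rule sampled_form_ge[OF dev])+
  have Mv: "(M *\<^sub>v \<alpha>) $ j = f (($) \<alpha>) (a j)" if "j < s" "\<alpha> \<in> carrier_vec h" for \<alpha> j
    using that by (auto simp: M_def f_def scalar_prod_def lessThan_atLeast0 intro!: sum.cong)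
  have Mc: "M *\<^sub>v \<alpha> \<in> carrier_vec s" if "\<alpha> \<in> carrier_vec h" for \<alpha>
    using M that by simp
  have h1: "\<beta> * W / h > 0" using beta W_pos h_pos by simp
  have Vpos: "V (($) \<alpha>) > 0" if "\<alpha> \<in> carrier_vec h" "\<alpha> \<noteq> 0\<^sub>v h" for \<alpha> :: "real vec"
  proof -
    have "\<exists>i<h. \<alpha> $ i \<noteq> 0"
    proof (rule ccontr)
      assume "\<not> (\<exists>i<h. \<alpha> $ i \<noteq> 0)"
      then have "\<alpha> = 0\<^sub>v h" using that(1) by (intro eq_vecI) auto
      then show False using that(2) by simp
    qed
    then obtain i where "i < h" "\<alpha> $ i \<noteq> 0" by blast
    then have "(\<Sum>i<h. (\<alpha> $ i)\<^sup>2) > 0" by (intro sum_pos2[of _ i]) auto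
    then show ?thesis using sq[of "($) \<alpha>"] h1 by (meson less_le_trans mult_pos_pos)
  qed
  show ?thesis
  proof (rule mu_ge[OF B sym _ M])
    show "h \<ge> 1" using h_pos by simp
  next
    fix \<alpha> :: "real vec" assume \<alpha>: "\<alpha> \<in> carrier_vec h" "\<alpha> \<noteq> 0\<^sub>v h"
    have "s * V (($) \<alpha>) / (10 * W) > 0" using Vpos[OF \<alpha>] W_pos s_pos by simp
    \<comment> \<open>Positivity of the sampled form already shows that \<open>M\<close> is
      injective: if no sample saw a nonzero value of the step function, \<open>T\<close> would be 0.
      No count of samples per cluster is needed.\<close>
    then have T0: "T (($) \<alpha>) \<noteq> 0" using T[of "($) \<alpha>"] by linarith
    have "\<exists>j<s. f (($) \<alpha>) (a j) \<noteq> 0"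
    proof (rule ccontr)
      assume "\<not> (\<exists>j<s. f (($) \<alpha>) (a j) \<noteq> 0)"
      then have "T (($) \<alpha>) = 0" unfolding T_def by (intro sum.neutral) auto
      then show False using T0 by simp
    qed
    then obtain j where "j < s" "f (($) \<alpha>) (a j) \<noteq> 0" by blast
    then show "M *\<^sub>v \<alpha> \<noteq> 0\<^sub>v s" using Mv[of j \<alpha>] \<alpha> by auto
  next
    fix \<alpha> :: "real vec" assume \<alpha>: "\<alpha> \<in> carrier_vec h"
    let ?x = "M *\<^sub>v \<alpha>" and ?\<alpha> = "($) \<alpha>"
    show "s * \<beta> / (100 * h * W) * \<rho> * (?x \<bullet> ?x) \<le> ?x \<bullet> (transpose_mat X * X *\<^sub>v ?x)"
    proof (cases "\<alpha> = 0\<^sub>v h")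
      case True
      then have "?x = 0\<^sub>v s" using M by (intro eq_vecI) auto
      then show ?thesis using B by simp
    next
      case False
      have V0: "V ?\<alpha> > 0" using Vpos \<alpha> False by blast
      have fle: "(f ?\<alpha> v)\<^sup>2 \<le> (\<Sum>i<h. (\<alpha> $ i)\<^sup>2)" for v
        unfolding f_def step_function_square[OF disj] by (intro sum_mono) auto
      have "?x \<bullet> ?x = (\<Sum>j<s. (f ?\<alpha> (a j))\<^sup>2)"
        using M by (auto simp: scalar_prod_def[of ?x] lessThan_atLeast0 Mv[OF _ \<alpha>] power2_eq_square
            simp del: index_mult_mat_vec intro!: sum.cong)
      also have "\<dots> \<le> s * (\<Sum>i<h. (\<alpha> $ i)\<^sup>2)"
        using sum_bounded_above[of "{..<s}" "\<lambda>j. (f ?\<alpha> (a j))\<^sup>2"] fle by simp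
      finally have xx: "?x \<bullet> ?x \<le> s * (\<Sum>i<h. (\<alpha> $ i)\<^sup>2)" .
      have "T ?\<alpha> = (\<Sum>j<s. ?x $ j * (\<Sum>l<h. \<alpha> $ l * q l (a j)) / sqrt (d (a j)))"
        unfolding T_def by (intro sum.cong refl) (simp only: Mv[OF _ \<alpha>] lessThan_iff)
      then have "\<rho> * (T ?\<alpha>)\<^sup>2 \<le> ((X *\<^sub>v ?x) \<bullet> (X *\<^sub>v ?x)) * V ?\<alpha>"
        using test[OF Mc[OF \<alpha>], of ?\<alpha>] by (simp only: V_def)
      moreover have "\<rho> * (s * V ?\<alpha> / (10 * W))\<^sup>2 \<le> \<rho> * (T ?\<alpha>)\<^sup>2"
        using T[of ?\<alpha>] V0 W_pos \<rho> by (intro mult_left_mono power_mono) auto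
      moreover have "\<rho> * (s * V ?\<alpha> / (10 * W))\<^sup>2 = \<rho> * (s\<^sup>2 * V ?\<alpha> / (100 * W\<^sup>2)) * V ?\<alpha>"
        by (simp add: power2_eq_square)
      ultimately have "\<rho> * (s\<^sup>2 * V ?\<alpha> / (100 * W\<^sup>2)) * V ?\<alpha> \<le> ((X *\<^sub>v ?x) \<bullet> (X *\<^sub>v ?x)) * V ?\<alpha>"
        by linarith
      \<comment> \<open>One factor \<open>V\<close> comes from the norm of the step function in the
        Cauchy-Schwarz bound and cancels against one of the two in the square of
        \<open>T\<close>.\<close>
      then have y: "\<rho> * (s\<^sup>2 * V ?\<alpha> / (100 * W\<^sup>2)) \<le> (X *\<^sub>v ?x) \<bullet> (X *\<^sub>v ?x)"
        using V0 by (rule mult_right_le_imp_le)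
      have "s * \<beta> / (100 * h * W) * \<rho> * (?x \<bullet> ?x) \<le> s * \<beta> / (100 * h * W) * \<rho> * (s * (\<Sum>i<h. (\<alpha> $ i)\<^sup>2))"
        using xx beta W_pos \<rho> by (intro mult_left_mono) auto
      also have "\<dots> = \<rho> * (s\<^sup>2 / (100 * W\<^sup>2)) * ((\<Sum>i<h. (\<alpha> $ i)\<^sup>2) * (\<beta> * W / h))"
        using W_pos h_pos by (simp add: field_simps power2_eq_square)
      also have "\<dots> \<le> \<rho> * (s\<^sup>2 / (100 * W\<^sup>2)) * V ?\<alpha>"
        using \<rho> sq[of ?\<alpha>] by (intro mult_left_mono) auto
      also have "\<dots> \<le> (X *\<^sub>v ?x) \<bullet> (X *\<^sub>v ?x)" using y by simp
      finally show ?thesis by (simp only: quad[OF Mc[OF \<alpha>]])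
    qed
  qed
qed

lemma prob_mu_sampled_gram_ge:
  fixes k n t :: nat and \<beta> \<eta> \<phi> :: real and E :: "nat \<Rightarrow> nat \<Rightarrow> bool" and P :: "nat pmf"
  assumes k: "1 \<le> k" and \<beta>: "0 < \<beta>" and \<eta>: "0 < \<eta>" "\<eta> \<le> 1 / 2"
    and \<phi>: "0 < \<phi>" "\<phi> \<le> 1 / 30"
    and G: "simple_graph n E" and uncl: "unclusterable n E k \<phi> \<beta>"
    and deg1: "\<forall>v<n. 1 \<le> deg n E v" and large: "exp (1 / \<beta>) \<le> real (vol n E {..<n})"
    and Psub: "set_pmf P \<subseteq> {..<n}"
    and Pnear: "\<forall>v<n. \<bar>pmf P v - real (deg n E v) / real (vol n E {..<n})\<bar>
          \<le> \<eta> * real (deg n E v) / real (vol n E {..<n})"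
  shows "let vG = real (vol n E {..<n});
        s = nat \<lceil>1600 * (real k + 1)^2 * ln (12 * (real k + 1)) * ln vG / (\<beta> * (1 - \<eta>))\<rceil>
    in measure_pmf.prob (Pi_pmf {..<s} 0 (\<lambda>_. P))
         {a. let X = deg_inv_sqrt_mat n E * (lazy_walk n E ^\<^sub>m t) * sample_mat n s a
             in mu (k + 1) (transpose_mat X * X)
                \<ge> 8 * (real k + 1) * ln (12 * (real k + 1)) / (\<beta> * (1 - \<eta>) * vG)
                   * (1 - 30 * \<phi>) ^ (2 * t)}
       \<ge> 2/3"
proof -
  define h where "h = k + 1"
  have rh: "real k + 1 = real h" by (simp add: h_def)
  define L where "L = ln (12 * real h)"
  have "exp 1 \<le> 12 * real h" using k exp_le by (simp add: h_def)
  then have L1: "L \<ge> 1" using k by (simp add: L_def h_def ln_ge_iff)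
  define W where "W = real (vol n E {..<n})"
  define s where "s = nat \<lceil>1600 * (real h)\<^sup>2 * L * ln W / (\<beta> * (1 - \<eta>))\<rceil>"
  have W: "W > 0" using large exp_gt_zero[of "1 / \<beta>"] unfolding W_def by linarith
  have lnW: "ln W \<ge> 1 / \<beta>" using large W by (simp add: W_def ln_ge_iff)
  have h_pos: "h > 0" by (simp add: h_def)
  \<comment> \<open>The second factor \<open>1 / \<beta>\<close> gained here is spent twice: in the
    Chebyshev bound, and in the final comparison, where the Gram bound has \<open>\<beta>\<close> in
    the numerator but the target has it in the denominator.\<close>
  have s_ge: "real s \<ge> 1600 * (real h)\<^sup>2 * L / (\<beta>\<^sup>2 * (1 - \<eta>))"
  proof -
    have "1600 * (real h)\<^sup>2 * L / (\<beta>\<^sup>2 * (1 - \<eta>)) = 1600 * (real h)\<^sup>2 * L / (\<beta> * (1 - \<eta>)) * (1 / \<beta>)"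
      by (simp add: power2_eq_square)
    also have "\<dots> \<le> 1600 * (real h)\<^sup>2 * L / (\<beta> * (1 - \<eta>)) * ln W"
      using lnW L1 \<beta> \<eta> by (intro mult_left_mono) auto
    also have "\<dots> \<le> real s" unfolding s_def by (simp add: real_nat_ceiling_ge)
    finally show ?thesis .
  qed
  have s113: "real s \<ge> 113 * (real h)\<^sup>2 / \<beta>\<^sup>2"
  proof -
    have "1 * 1 \<le> L * (1 / (1 - \<eta>))" using L1 \<eta> by (intro mult_mono) auto
    then have "113 * (real h)\<^sup>2 / \<beta>\<^sup>2 * 1 \<le> 1600 * (real h)\<^sup>2 / \<beta>\<^sup>2 * (L * (1 / (1 - \<eta>)))"
      using \<beta> by (intro mult_mono divide_right_mono) auto
    then show ?thesis using s_ge by simp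
  qed
  have "113 * (real h)\<^sup>2 / \<beta>\<^sup>2 > 0" using h_pos \<beta> by simp
  then have s_pos: "s > 0" using s113 by simp
  obtain C where sub: "\<forall>i<h. C i \<subseteq> {..<n}"
    and disj: "\<forall>i<h. \<forall>j<h. i \<noteq> j \<longrightarrow> C i \<inter> C j = {}"
    and vol_ge: "\<forall>i<h. \<beta> * W / h \<le> real (vol n E (C i))"
    and cond: "\<forall>i<h. conductance n E (C i) \<le> \<phi>"
    using uncl unfolding unclusterable_def h_def W_def by blast
  have cut: "\<forall>i<h. real (cut_edges n E (C i)) \<le> \<phi> * real (vol n E (C i))"
  proof (intro allI impI)
    fix i assume i: "i < h"
    have "\<beta> * W / h > 0" using \<beta> W h_pos by simp
    \<comment> \<open>Division by zero yields 0, so positivity of the volume is secured before the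
      conductance bound is turned into a bound on the cut.\<close>
    then have "real (vol n E (C i)) > 0" using vol_ge i by fastforce
    then show "real (cut_edges n E (C i)) \<le> \<phi> * real (vol n E (C i))"
      using cond i unfolding conductance_def by (metis pos_divide_le_eq)
  qed
  obtain q where q_near: "\<And>\<alpha>. (\<Sum>v<n. ((\<Sum>i<h. \<alpha> i * of_bool (v \<in> C i)) * sqrt (deg n E v) - (\<Sum>l<h. \<alpha> l * q l v))\<^sup>2)
      \<le> (\<Sum>i<h. (\<alpha> i)\<^sup>2 * real (vol n E (C i))) / 30"
    and q_norm: "\<And>l. l < h \<Longrightarrow> (\<Sum>v<n. (q l v)\<^sup>2) \<le> real (vol n E (C l))"
    and q_test: "\<forall>\<alpha> t s a x. (\<forall>j<s. a j < n) \<longrightarrow> x \<in> carrier_vec s \<longrightarrow>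
     (let y = deg_inv_sqrt_mat n E * lazy_walk n E ^\<^sub>m t * sample_mat n s a *\<^sub>v x
      in (1 - 30 * \<phi>) ^ (2 * t) * (\<Sum>j<s. x $ j * (\<Sum>l<h. \<alpha> l * q l (a j)) / sqrt (deg n E (a j)))\<^sup>2
           \<le> (y \<bullet> y) * (\<Sum>i<h. (\<alpha> i)\<^sup>2 * real (vol n E (C i))))"
    using spectral_test_functions[OF G deg1 \<phi> sub disj cut] by blast
  interpret clustered_sampling n "\<lambda>v. real (deg n E v)" W \<eta> P C q h "\<lambda>i. real (vol n E (C i))" \<beta>
  proof
    fix v assume v: "v < n"
    show "0 < real (deg n E v)" using deg1 v by force
    show "\<bar>pmf P v - real (deg n E v) / W\<bar> \<le> \<eta> * real (deg n E v) / W"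
      using Pnear v by (simp add: W_def)
  qed (use W \<eta> \<beta> Psub sub disj vol_ge h_pos q_near q_norm sum_disjoint_vol_le[OF sub disj] in
      \<open>auto simp: sum_of_bool_deg_eq_vol W_def\<close>)
  let ?X = "\<lambda>a. deg_inv_sqrt_mat n E * lazy_walk n E ^\<^sub>m t * sample_mat n s a"
  let ?c = "8 * real h * L / (\<beta> * (1 - \<eta>) * W)"
  have mu: "?c * (1 - 30 * \<phi>) ^ (2 * t) \<le> mu h (transpose_mat (?X a) * ?X a)"
    if a: "\<forall>j<s. a j < n" and dev: "(\<Sum>p\<in>{..<h} \<times> {..<h}. (deviation s a p)\<^sup>2) < (s * \<beta> / (5 * h))\<^sup>2" for a
  proof -
    have X: "?X a \<in> carrier_mat n s"
      by (intro carrier_matI) (simp_all add: deg_inv_sqrt_mat_def sample_mat_def)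
    have \<rho>: "(1 - 30 * \<phi>) ^ (2 * t) \<ge> 0" using \<phi> by (intro zero_le_power) auto
    \<comment> \<open>The Gram bound with \<open>s_ge\<close> gives 1600/100 = 16, twice the
      required 8; the intermediate 200 makes this first line an equality.\<close>
    have "8 * real h * L / (\<beta> * (1 - \<eta>) * W) = 1600 * (real h)\<^sup>2 * L / (\<beta>\<^sup>2 * (1 - \<eta>)) * (\<beta> / (200 * h * W))"
      using h_pos \<beta> \<eta> W by (simp add: field_simps power2_eq_square)
    also have "\<dots> \<le> real s * (\<beta> / (200 * h * W))"
      using s_ge \<beta> W by (intro mult_right_mono) auto
    also have "\<dots> \<le> real s * \<beta> / (100 * h * W)"
      using \<beta> W h_pos by (simp add: field_simps)
    finally have "?c * (1 - 30 * \<phi>) ^ (2 * t) \<le> real s * \<beta> / (100 * h * W) * (1 - 30 * \<phi>) ^ (2 * t)"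
      using \<rho> by (rule mult_right_mono)
    also have "\<dots> \<le> mu h (transpose_mat (?X a) * ?X a)"
      using q_test a by (intro mu_sampled_gram_ge[OF X s_pos \<rho>, of a] less_imp_le[OF dev]) (simp add: Let_def)
    finally show ?thesis .
  qed
  have "2 / 3 \<le> measure_pmf.prob (Pi_pmf {..<s} 0 (\<lambda>_. P))
    {a. (\<Sum>p\<in>{..<h} \<times> {..<h}. (deviation s a p)\<^sup>2) < (s * \<beta> / (5 * h))\<^sup>2}"
    by (rule prob_deviation_small[OF s113])
  also have "\<dots> \<le> measure_pmf.prob (Pi_pmf {..<s} 0 (\<lambda>_. P))
    {a. ?c * (1 - 30 * \<phi>) ^ (2 * t) \<le> mu h (transpose_mat (?X a) * ?X a)}"
  \<comment> \<open>The inclusion of events is needed only on the support of the product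
    distribution, where every sample is a vertex below \<open>n\<close>.\<close>
  proof (intro measure_pmf.finite_measure_mono_AE AE_pmfI impI)
    fix a assume "a \<in> set_pmf (Pi_pmf {..<s} 0 (\<lambda>_. P))"
    then have "\<forall>j<s. a j < n"
      using set_Pi_pmf_subset'[of "{..<s}" 0 "\<lambda>_. P"] Psub by (auto simp: PiE_dflt_def)
    moreover assume "a \<in> {a. (\<Sum>p\<in>{..<h} \<times> {..<h}. (deviation s a p)\<^sup>2) < (s * \<beta> / (5 * h))\<^sup>2}"
    ultimately show "a \<in> {a. ?c * (1 - 30 * \<phi>) ^ (2 * t) \<le> mu h (transpose_mat (?X a) * ?X a)}"
      using mu by blast
  qed simp
  finally show ?thesis
    unfolding Let_def rh L_def[symmetric] W_def[symmetric] s_def[symmetric] h_def[symmetric] .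
qed

theorem theorem3p3:
  "\<forall>(k::nat) (\<beta>::real) (\<eta>::real).
     k \<ge> 1 \<and> 0 < \<beta> \<and> \<beta> < 1 \<and> 0 < \<eta> \<and> \<eta> \<le> 1/2 \<longrightarrow>
     (\<exists>N0::real. \<forall>(n::nat) (E::nat \<Rightarrow> nat \<Rightarrow> bool) (\<phi>::real) (t::nat) (P::nat pmf).
        0 < \<phi> \<and> \<phi> \<le> 1/30 \<and> t \<ge> 1 \<and>
        simple_graph n E \<and> unclusterable n E k \<phi> \<beta> \<and>
        (\<forall>v < n. deg n E v \<ge> 1) \<and>
        real (vol n E {..<n}) \<ge> N0 \<and>
        set_pmf P \<subseteq> {..<n} \<and>
        (\<forall>v < n. \<bar>pmf P v - real (deg n E v) / real (vol n E {..<n})\<bar>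
                   \<le> \<eta> * real (deg n E v) / real (vol n E {..<n}))
        \<longrightarrow>
        (let vG = real (vol n E {..<n});
             s = nat \<lceil>1600 * (real k + 1)^2 * ln (12 * (real k + 1)) * ln vG / (\<beta> * (1 - \<eta>))\<rceil>
         in measure_pmf.prob (Pi_pmf {..<s} 0 (\<lambda>_. P))
              {a. let X = deg_inv_sqrt_mat n E * (lazy_walk n E ^\<^sub>m t) * sample_mat n s a
                  in mu (k + 1) (transpose_mat X * X)
                     \<ge> 8 * (real k + 1) * ln (12 * (real k + 1)) / (\<beta> * (1 - \<eta>) * vG)
                        * (1 - 30 * \<phi>) ^ (2 * t)}
            \<ge> 2/3))"
  \<comment> \<open>The threshold is left open by \<open>exI\<close> and becomes
    \<open>exp (1 / \<beta>)\<close> when the volume hypothesis is matched, independently of the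
    graph.\<close>
  by (intro allI impI exI, elim conjE, rule prob_mu_sampled_gram_ge; assumption)

end
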